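(* Let $D>2$ and $0<\alpha\le 2$. For the CBC-WCT II described in the context, the strong secrecy capacity satisfies $$C_s(\alpha)\ \ge\ \begin{cases}\dfrac12+\dfrac{3(1-\alpha)}{4D}, & 0<\alpha<1,\\[2mm] 1-\dfrac{\alpha}{2}, & 1\le\alpha\le 2,\end{cases}$$ i.e., every file rate below the right-hand side is achievable with strong secrecy.
   Context: The caching broadcast channel with a wire and cache tapping adversary of type II (CBC-WCT II) is defined as follows. Fix an integer $D\ge 2$ (library size), a block length $n$, and a tapping fraction $\alpha\in(0,2]$; put $\mu=\alpha n$ (assumed to be an integer, or rounded). A transmitter holds $D$ mutually independent files $W_1,\dots,W_D$, each uniform on $[1:2^{nR_s}]$, and has access to private randomness independent of the files. There are two receivers, each with a cache memory of $n/2$ bits. Communication takes place in two phases over a noiseless binary broadcast channel. (i) Cache placement: without knowledge of future demands, the transmitter sends $\mathbf X_c^n\in\{0,1\}^n$, a (possibly randomized) function of $W_{[1:D]}$; receiver $j\in\{1,2\}$ stores $M_{c,j}=f_{c,j}(\mathbf X_c^n)\in[1:2^{n/2}]$. (ii) Delivery: the receivers reveal a demand vector $\mathbf d=(d_1,d_2)\in[1:D]^2$; the transmitter sends $\mathbf X_{\mathbf d}^n\in\{0,1\}^n$, a (possibly randomized) function of $W_{[1:D]}$ and $\mathbf d$ (it may use the same private randomness as in placement). Receiver $j$ outputs $\hat W_{d_j}=g_{\mathbf d,j}(M_{c,j},\mathbf X_{\mathbf d}^n)$. Adversary: it chooses subsets $S_1,S_2\subseteq[1:n]$ with $|S_1|+|S_2|\le\mu$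 (unknown to the legitimate parties, who know only $\mu$), and observes $\mathbf Z_{S_1}^n,\mathbf Z_{S_2}^n\in\{0,1,?\}^n$ where $Z_{S_1,i}=X_{c,i}$ if $i\in S_1$ and $Z_{S_1,i}=?$ (erasure) otherwise, and $Z_{S_2,i}=X_{\mathbf d,i}$ if $i\in S_2$ and $?$ otherwise. A file rate $R_s$ is achievable with strong secrecy if there is a sequence of such codes (indexed by $n$) with $\lim_{n\to\infty}\max_{\mathbf d\in[1:D]^2}\Pr\big(\bigcup_{j=1,2}\{\hat W_{d_j}\neq W_{d_j}\}\big)=0$ and $\lim_{n\to\infty}\max_{S_1,S_2\subseteq[1:n]:|S_1|+|S_2|\le\mu} I(W_{[1:D]};\mathbf Z_{S_1}^n,\mathbf Z_{S_2}^n)=0$. The strong secrecy capacity $C_s(\alpha)$ is the supremum of achievable $R_s$. *)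

theory Defs
  imports "HOL-Probability.Probability"
begin

text \<open>Caching broadcast channel with wire and cache tapping adversary of type II.
  Files are indexed by 0..<D, receivers by j in {0,1}, channel positions by 0..<n.
  A file realization is a function w :: nat => nat with w i < M for i < D.\<close>

record cbc_code =
  enc_c :: "(nat \<Rightarrow> nat) \<Rightarrow> nat \<Rightarrow> bool list"
    \<comment> \<open>placement codeword, function of files and private randomness\<close>
  cache :: "nat \<Rightarrow> bool list \<Rightarrow> nat"
    \<comment> \<open>cache function of receiver j applied to the placement codeword\<close>
  enc_d :: "nat \<times> nat \<Rightarrow> (nat \<Rightarrow> nat) \<Rightarrow> nat \<Rightarrow> bool list"
    \<comment> \<open>delivery codeword, function of demand, files and private randomness\<close>
  dec :: "nat \<times> nat \<Rightarrow> nat \<Rightarrow> nat \<Rightarrow> bool list \<Rightarrow> nat"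
    \<comment> \<open>decoder of receiver j for demand d: cache content, delivery codeword\<close>
  rnd :: "nat pmf"

definition num_msgs :: "nat \<Rightarrow> real \<Rightarrow> nat" where
  "num_msgs n R = nat \<lceil>2 powr (real n * R)\<rceil>"

definition valid_code :: "nat \<Rightarrow> cbc_code \<Rightarrow> bool" where
  "valid_code n c \<longleftrightarrow>
     finite (set_pmf (rnd c)) \<and>
     (\<forall>w u. length (enc_c c w u) = n) \<and>
     (\<forall>d w u. length (enc_d c d w u) = n) \<and>
     (\<forall>j x. j < 2 \<longrightarrow> real (cache c j x) + 1 \<le> 2 powr (real n / 2))"

definition files_pmf :: "nat \<Rightarrow> nat \<Rightarrow> (nat \<Rightarrow> nat) pmf" where
  "files_pmf D M = pmf_of_set (Pi\<^sub>E {..<D} (\<lambda>_. {..<M}))"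

definition joint_pmf :: "nat \<Rightarrow> nat \<Rightarrow> cbc_code \<Rightarrow> ((nat \<Rightarrow> nat) \<times> nat) pmf" where
  "joint_pmf D M c = pair_pmf (files_pmf D M) (rnd c)"

definition demand :: "nat \<times> nat \<Rightarrow> nat \<Rightarrow> nat" where
  "demand d j = (if j = 0 then fst d else snd d)"

definition error_prob :: "nat \<Rightarrow> nat \<Rightarrow> cbc_code \<Rightarrow> nat \<times> nat \<Rightarrow> real" where
  "error_prob D M c d = measure_pmf.prob (joint_pmf D M c)
     {(w, u). \<exists>j<2. dec c d j (cache c j (enc_c c w u)) (enc_d c d w u) \<noteq> w (demand d j)}"

definition tap :: "nat \<Rightarrow> nat set \<Rightarrow> bool list \<Rightarrow> bool option list" where
  "tap n S x = map (\<lambda>i. if i \<in> S then Some (x ! i) else None) [0..<n]"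

definition mutual_info :: "('a \<times> 'b) pmf \<Rightarrow> real" where
  "mutual_info p = (\<Sum>(a, b)\<in>set_pmf p.
      pmf p (a, b) * log 2 (pmf p (a, b) / (pmf (map_pmf fst p) a * pmf (map_pmf snd p) b)))"

definition leakage :: "nat \<Rightarrow> nat \<Rightarrow> nat \<Rightarrow> cbc_code \<Rightarrow> nat \<times> nat \<Rightarrow> nat set \<Rightarrow> nat set \<Rightarrow> real" where
  "leakage D n M c d S1 S2 = mutual_info (map_pmf
      (\<lambda>(w, u). (w, tap n S1 (enc_c c w u), tap n S2 (enc_d c d w u))) (joint_pmf D M c))"

definition tap_sets :: "real \<Rightarrow> nat \<Rightarrow> (nat set \<times> nat set) set" where
  "tap_sets \<alpha> n = {(S1, S2). S1 \<subseteq> {..<n} \<and> S2 \<subseteq> {..<n} \<and> real (card S1 + card S2) \<le> \<alpha> * real n}"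

definition achievable :: "nat \<Rightarrow> real \<Rightarrow> real \<Rightarrow> bool" where
  "achievable D \<alpha> R \<longleftrightarrow> (\<exists>code :: nat \<Rightarrow> cbc_code.
     (\<forall>n. valid_code n (code n)) \<and>
     (\<lambda>n. Max ((\<lambda>d. error_prob D (num_msgs n R) (code n) d) ` ({..<D} \<times> {..<D})))
        \<longlonglongrightarrow> 0 \<and>
     (\<lambda>n. Max ((\<lambda>d. Max ((\<lambda>(S1, S2). leakage D n (num_msgs n R) (code n) d S1 S2)
                              ` tap_sets \<alpha> n)) ` ({..<D} \<times> {..<D})))
        \<longlonglongrightarrow> 0)"

end

theory Submission
  imports Defs "HOL-Real_Asymp.Real_Asymp"
begin

text \<open>All codewords are bit vectors, and the secret bits are \<open>F\<^sub>2\<close>-linear functions of them (sets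
  stand for vectors, symmetric difference for addition). Each receiver caches its own part of every
  file together with some key bits; the delivery phase sends the XOR of the two parts that the
  receivers miss of their files, and the uncached rest of both files, masked by the keys. For
  \<open>\<alpha> \<ge> 1\<close> only keys are cached. The channel inputs are uniformly random solutions of the resulting
  linear system.

  If the columns of the untapped positions span all secret bits, the observation is independent of
  the files. One binary matrix of this rate cannot do so for all tap sets at once, so the matrix is
  selected by a short uniform seed sent in the clear: out of \<open>2 ^ b\<close> suitably chosen matrices only
  \<open>O(n)\<close> are bad for any given tap set, and \<open>b = \<lfloor>\<epsilon> n\<rfloor>\<close> costs no rate in the limit. The leakage is then
  at most the probability of a bad seed times the entropy of the files.\<close>

section \<open>Linear systems over the field with two elements\<close>

text \<open>For \<open>i < q\<close> the bit at \<open>Private j i\<close> is a parity over the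
  inputs of both phases. Receiver \<open>j\<close> caches the placement half, which acts as a
  one-time pad, and computes the delivery half later. An adversary that taps one phase completely
  thus still misses a half of each such bit. A parity of secret bits is safe unless the tapped
  inputs determine it, so for each kind of parity the secret bits must be fewer than the untapped
  inputs they depend on. In the worst case there are (2 - \<alpha>)n of these for parities over both
  phases, and (1 - \<alpha>)n for parities over placement alone or delivery alone. Up to terms of
  order \<epsilon>n this asks for 2Dp + p + 2r <= (2 - \<alpha>)n, 2Dp <= (1 - \<alpha>)n and p +
  2(r - q) <= (1 - \<alpha>)n; encoding asks for p + 2r <= n and the cache for Dp + q <= n/2. A file
  has 2p + r bits. For \<alpha> < 1, p = (1 - \<alpha>)n/(2D), q = \<alpha>n/2 and r = (n - p)/2
  make all five tight and give n/2 + 3p/2 bits. For \<alpha> >= 1, p = 0 and q = r = (1 -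
  \<alpha>/2)n satisfy those that remain.\<close>

lemma odd_card_sym_diff:
  assumes "finite A" "finite B"
  shows "odd (card (sym_diff A B)) \<longleftrightarrow> odd (card A) \<noteq> odd (card B)"
proof -
  have "card (sym_diff A B) = card (A - B) + card (B - A)"
    using assms by (intro card_Un_disjoint) auto
  moreover have "card A = card (A - B) + card (A \<inter> B)"
    using assms by (subst card_Un_disjoint[symmetric]) (auto intro: arg_cong[where f = card])
  moreover have "card B = card (B - A) + card (A \<inter> B)"
    using assms by (subst card_Un_disjoint[symmetric]) (auto intro: arg_cong[where f = card])
  ultimately show ?thesis
    by auto
qed

text \<open>The matrix with columns \<open>g i\<close>, applied to the indicator vector of
  \<open>X\<close>.\<close>

definition lin :: "('i \<Rightarrow> 'c set) \<Rightarrow> 'i set \<Rightarrow> 'c set" where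
  "lin g X = {c. odd (card {i \<in> X. c \<in> g i})}"

lemma lin_empty [simp]: "lin g {} = {}"
  by (simp add: lin_def)

lemma lin_sym_diff:
  assumes "finite X" "finite Y"
  shows "lin g (sym_diff X Y) = sym_diff (lin g X) (lin g Y)"
proof -
  have "{i \<in> sym_diff X Y. c \<in> g i} = sym_diff {i \<in> X. c \<in> g i} {i \<in> Y. c \<in> g i}" for c
    by auto
  then show ?thesis
    using assms by (auto simp: lin_def odd_card_sym_diff)
qed

lemma lin_singleton [simp]: "lin g {i} = g i"
proof -
  have "{j. j = i \<and> c \<in> g j} = (if c \<in> g i then {i} else {})" for c
    by auto
  then show ?thesis
    by (auto simp: lin_def)
qed

lemma lin_insert:
  assumes "finite X" "i \<notin> X"
  shows "lin g (insert i X) = sym_diff (g i) (lin g X)"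
proof -
  have "insert i X = sym_diff {i} X"
    using assms by auto
  then show ?thesis
    using assms lin_sym_diff[of "{i}" X g] by simp
qed

lemma lin_subset:
  assumes "\<And>i. i \<in> X \<Longrightarrow> g i \<subseteq> K"
  shows "lin g X \<subseteq> K"
proof
  fix c assume "c \<in> lin g X"
  then have "{i \<in> X. c \<in> g i} \<noteq> {}"
    by (auto simp: lin_def simp del: Collect_empty_eq)
  then show "c \<in> K"
    using assms by auto
qed

text \<open>For finite \<open>B\<close> this is (-1) to the power of the size of
  \<open>B \<inter> T\<close>, a character of the group of sets under symmetric difference.\<close>

definition chi :: "'c set \<Rightarrow> 'c set \<Rightarrow> real" where
  "chi B T = (\<Prod>c\<in>B. if c \<in> T then - 1 else 1)"

lemma chi_empty [simp]: "chi {} T = 1" "chi B {} = 1"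
  by (simp_all add: chi_def)

lemma chi_values: "chi B T = 1 \<or> chi B T = - 1"
  unfolding chi_def by (induction B rule: infinite_finite_induct) auto

lemma chi_sym_diff: "chi B (sym_diff S T) = chi B S * chi B T"
  unfolding chi_def prod.distrib[symmetric] by (intro prod.cong) auto

lemma chi_lin:
  assumes "finite X"
  shows "chi B (lin g X) = (\<Prod>i\<in>X. chi B (g i))"
  using assms by (induction X) (auto simp: lin_insert chi_sym_diff)

lemma chi_singleton:
  assumes "finite B" "c \<in> B"
  shows "chi B {c} = - 1"
proof -
  have "(\<Prod>x\<in>B - {c}. if x \<in> {c} then - 1 else 1 :: real) = 1"
    by (intro prod.neutral) auto
  then show ?thesis
    using assms by (simp add: chi_def prod.remove[of B c])
qed

lemma sum_Pow_prod:
  fixes f :: "'a \<Rightarrow> real"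
  assumes "finite A"
  shows "(\<Sum>X\<in>Pow A. \<Prod>i\<in>X. f i) = (\<Prod>i\<in>A. f i + 1)"
  using assms by (simp add: prod_add)

text \<open>Linear dependence of the rows \<open>J\<close> after restriction to the columns
  \<open>U\<close>. With \<open>U\<close> the untapped positions, such a \<open>B\<close> is a
  parity of secret bits that the tapped inputs determine.\<close>

definition annihilated :: "('i \<Rightarrow> 'c set) \<Rightarrow> 'i set \<Rightarrow> 'c set \<Rightarrow> bool" where
  "annihilated g U J \<longleftrightarrow> (\<exists>B. B \<subseteq> J \<and> B \<noteq> {} \<and> (\<forall>i\<in>U. chi B (g i) = 1))"

text \<open>Fourier inversion over the characters \<^term>\<open>chi B\<close> counts the solutions of a linear
  system; without an annihilating character only the trivial one contributes.\<close>

lemma lin_surj: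
  assumes fin: "finite U" "finite J" and "\<not> annihilated g U J" and "t \<subseteq> J"
  shows "\<exists>X\<subseteq>U. lin g X \<inter> J = t"
proof (rule ccontr)
  assume neg: "\<not> ?thesis"
  \<comment> \<open>The inner sum is \<open>2 ^ card J\<close> if \<open>X\<close> solves the system
    and 0 otherwise, so without a solution the double sum vanishes.\<close>
  have "(\<Sum>X\<in>Pow U. \<Sum>B\<in>Pow J. chi B (sym_diff (lin g X) t)) = 0"
  proof (rule sum.neutral, rule ballI)
    fix X assume "X \<in> Pow U"
    then have "\<exists>c\<in>J. c \<in> sym_diff (lin g X) t"
      using neg \<open>t \<subseteq> J\<close> by blast
    then have "(\<Prod>c\<in>J. (if c \<in> sym_diff (lin g X) t then - 1 else 1) + 1 :: real) = 0"
      by (intro prod_zero) (use fin in auto)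
    then show "(\<Sum>B\<in>Pow J. chi B (sym_diff (lin g X) t)) = 0"
      unfolding chi_def by (simp only: sum_Pow_prod[OF fin(2)])
  qed
  also have "(\<Sum>X\<in>Pow U. \<Sum>B\<in>Pow J. chi B (sym_diff (lin g X) t))
      = (\<Sum>X\<in>Pow U. \<Sum>B\<in>Pow J. chi B t * (\<Prod>i\<in>X. chi B (g i)))"
    using finite_subset[OF _ fin(1)] by (intro sum.cong) (auto simp: chi_sym_diff chi_lin)
  \<comment> \<open>Exchanging the sums evaluates the same quantity through the characters, where
    every nonempty \<open>B\<close> has a factor -1 + 1.\<close>
  also have "\<dots> = (\<Sum>B\<in>Pow J. chi B t * (\<Prod>i\<in>U. chi B (g i) + 1))"
    by (subst sum.swap) (simp add: sum_distrib_left[symmetric] sum_Pow_prod fin(1))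
  also have "\<dots> = (\<Sum>B\<in>Pow J. if B = {} then 2 ^ card U else 0)"
  proof (intro sum.cong refl)
    fix B assume "B \<in> Pow J"
    show "chi B t * (\<Prod>i\<in>U. chi B (g i) + 1) = (if B = {} then 2 ^ card U else 0)"
    proof (cases "B = {}")
      case False
      then obtain i where "i \<in> U" "chi B (g i) \<noteq> 1"
        using \<open>B \<in> Pow J\<close> assms(3) by (auto simp: annihilated_def)
      then have "(\<Prod>i\<in>U. chi B (g i) + 1) = 0"
        using chi_values[of B "g i"] by (intro prod_zero fin bexI[of _ i]) auto
      then show ?thesis
        using False by simp
    qed simp
  qed
  also have "\<dots> = 2 ^ card U"
    using fin by (simp add: sum.delta)
  finally show False
    by simp
qed

text \<open>Toggling one element of \<open>B \<inter> G\<close> flips the sign of the character,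
  which pairs the two values.\<close>

lemma card_chi_kernel:
  assumes "finite B" "finite G" "B \<inter> G \<noteq> {}"
  shows "2 * card {T \<in> Pow G. chi B T = 1} = card (Pow G)"
proof -
  obtain b where b: "b \<in> B" "b \<in> G"
    using assms by auto
  have flip: "chi B (sym_diff {b} T) = - chi B T" for T
    by (simp only: chi_sym_diff chi_singleton[OF assms(1) b(1)] mult_minus1)
  have "bij_betw (sym_diff {b}) {T \<in> Pow G. chi B T = 1} {T \<in> Pow G. chi B T \<noteq> 1}"
  proof (rule bij_betwI[where g = "sym_diff {b}"])
    show "sym_diff {b} \<in> {T \<in> Pow G. chi B T = 1} \<rightarrow> {T \<in> Pow G. chi B T \<noteq> 1}"
      using b unfolding Pi_iff mem_Collect_eq flip by auto
    show "sym_diff {b} \<in> {T \<in> Pow G. chi B T \<noteq> 1} \<rightarrow> {T \<in> Pow G. chi B T = 1}"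
      using b chi_values[of B] unfolding Pi_iff mem_Collect_eq flip by fastforce
  qed auto
  then have "card {T \<in> Pow G. chi B T = 1} = card {T \<in> Pow G. chi B T \<noteq> 1}"
    by (rule bij_betw_same_card)
  moreover have "card (Pow G)
      = card ({T \<in> Pow G. chi B T = 1} \<union> {T \<in> Pow G. chi B T \<noteq> 1})"
    by (rule arg_cong[where f = card]) auto
  moreover have "\<dots> = card {T \<in> Pow G. chi B T = 1} + card {T \<in> Pow G. chi B T \<noteq> 1}"
    using assms(2) by (intro card_Un_disjoint) auto
  ultimately show ?thesis
    by simp
qed

text \<open>For independent uniform columns, \<open>chi B\<close> is a fair sign on each column
  whose range meets \<open>B\<close> and constantly 1 on the others.\<close>

lemma card_annihilated_by:
  assumes fin: "finite I" "\<And>i. i \<in> I \<Longrightarrow> finite (G i)" "finite B" and "U \<subseteq> I"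
  shows "real (card {\<omega> \<in> Pi\<^sub>E I (\<lambda>i. Pow (G i)). \<forall>i\<in>U. chi B (\<omega> i) = 1})
    = real (card (Pi\<^sub>E I (\<lambda>i. Pow (G i)))) * (1/2) ^ card {i \<in> U. B \<inter> G i \<noteq> {}}"
proof -
  define h where "h i = (if i \<in> U then {T \<in> Pow (G i). chi B T = 1} else Pow (G i))" for i
  have h_mem: "T \<in> h i \<longleftrightarrow> T \<in> Pow (G i) \<and> (i \<in> U \<longrightarrow> chi B T = 1)" for T i
    by (simp add: h_def)
  have "{\<omega> \<in> Pi\<^sub>E I (\<lambda>i. Pow (G i)). \<forall>i\<in>U. chi B (\<omega> i) = 1} = Pi\<^sub>E I h"
    using \<open>U \<subseteq> I\<close> by (intro set_eqI) (simp only: mem_Collect_eq PiE_iff h_mem, blast)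
  then have "real (card {\<omega> \<in> Pi\<^sub>E I (\<lambda>i. Pow (G i)). \<forall>i\<in>U. chi B (\<omega> i) = 1})
      = (\<Prod>i\<in>I. real (card (h i)))"
    by (simp add: card_PiE fin)
  also have "\<dots> = (\<Prod>i\<in>I. real (card (Pow (G i)))
      * (if i \<in> {i \<in> U. B \<inter> G i \<noteq> {}} then 1/2 else 1))"
  proof (intro prod.cong refl)
    fix i assume i: "i \<in> I"
    have "chi B T = 1" if "B \<inter> G i = {}" "T \<subseteq> G i" for T
      using that unfolding chi_def by (intro prod.neutral) auto
    then have *: "B \<inter> G i = {} \<Longrightarrow> {T \<in> Pow (G i). chi B T = 1} = Pow (G i)"
      by auto
    show "real (card (h i)) = real (card (Pow (G i)))
      * (if i \<in> {i \<in> U. B \<inter> G i \<noteq> {}} then 1/2 else 1)"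
      using * card_chi_kernel[OF fin(3) fin(2)[OF i]]
      by (cases "B \<inter> G i = {}") (auto simp: h_def)
  qed
  also have "\<dots> = (\<Prod>i\<in>I. real (card (Pow (G i))))
      * (\<Prod>i\<in>I. if i \<in> {i \<in> U. B \<inter> G i \<noteq> {}} then 1/2 else 1)"
    by (rule prod.distrib)
  also have "(\<Prod>i\<in>I. if i \<in> {i \<in> U. B \<inter> G i \<noteq> {}} then 1/2 else 1 :: real)
      = (\<Prod>i\<in>I \<inter> {i \<in> U. B \<inter> G i \<noteq> {}}. 1/2)"
    by (rule prod.inter_restrict[OF fin(1), symmetric])
  also have "I \<inter> {i \<in> U. B \<inter> G i \<noteq> {}} = {i \<in> U. B \<inter> G i \<noteq> {}}"
    using \<open>U \<subseteq> I\<close> by auto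
  also have "(\<Prod>i\<in>I. real (card (Pow (G i)))) = real (card (Pi\<^sub>E I (\<lambda>i. Pow (G i))))"
    by (simp add: card_PiE fin)
  finally show ?thesis
    by simp
qed

text \<open>Union bound over the nonempty \<open>B\<close>. The size conditions of the scheme serve
  to keep this sum below \<open>(1/2) ^ b\<close>.\<close>

lemma card_annihilated:
  assumes fin: "finite I" "\<And>i. i \<in> I \<Longrightarrow> finite (G i)" "finite J" and "U \<subseteq> I"
  shows "real (card {\<omega> \<in> Pi\<^sub>E I (\<lambda>i. Pow (G i)). annihilated \<omega> U J})
    \<le> real (card (Pi\<^sub>E I (\<lambda>i. Pow (G i))))
        * (\<Sum>B\<in>Pow J - {{}}. (1/2) ^ card {i \<in> U. B \<inter> G i \<noteq> {}})"
proof -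
  let ?P = "Pi\<^sub>E I (\<lambda>i. Pow (G i))"
  have "{\<omega> \<in> ?P. annihilated \<omega> U J}
      = (\<Union>B\<in>Pow J - {{}}. {\<omega> \<in> ?P. \<forall>i\<in>U. chi B (\<omega> i) = 1})"
    unfolding annihilated_def by blast
  also have "card \<dots> \<le> (\<Sum>B\<in>Pow J - {{}}. card {\<omega> \<in> ?P. \<forall>i\<in>U. chi B (\<omega> i) = 1})"
    using fin by (intro card_UN_le) auto
  finally have "real (card {\<omega> \<in> ?P. annihilated \<omega> U J})
      \<le> (\<Sum>B\<in>Pow J - {{}}. real (card {\<omega> \<in> ?P. \<forall>i\<in>U. chi B (\<omega> i) = 1}))"
    by (simp flip: of_nat_sum)
  also have "\<dots> = (\<Sum>B\<in>Pow J - {{}}. real (card ?P) * (1/2) ^ card {i \<in> U. B \<inter> G i \<noteq> {}})"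
    using finite_subset[OF _ fin(3)] assms by (intro sum.cong card_annihilated_by) auto
  finally show ?thesis
    by (simp add: sum_distrib_left)
qed

text \<open>Derandomisation: the expectation of the potential
  \<^term>\<open>\<Sum>e\<in>E. 2 ^ card {s. s < N \<and> \<omega> s \<in> bad e}\<close>, the next \<^term>\<open>\<omega> N\<close> being uniform, grows by
  a factor of at most \<^term>\<open>1 + p\<close>, so some choice of \<^term>\<open>\<omega> N\<close> does no worse.\<close>

lemma exists_sequence_few_bad:
  fixes bad :: "'e \<Rightarrow> 'a set" and p :: real
  assumes "finite \<Omega>" "\<Omega> \<noteq> {}" "finite E"
    and bad: "\<And>e. e \<in> E \<Longrightarrow> real (card {x \<in> \<Omega>. x \<in> bad e}) \<le> p * real (card \<Omega>)" and "0 \<le> p"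
  shows "\<exists>\<omega>. (\<forall>s. \<omega> s \<in> \<Omega>) \<and>
    (\<Sum>e\<in>E. 2 ^ card {s. s < N \<and> \<omega> s \<in> bad e}) \<le> real (card E) * (1 + p) ^ N"
proof (induction N)
  case 0
  obtain x where "x \<in> \<Omega>"
    using assms(2) by auto
  then show ?case
    by (intro exI[of _ "\<lambda>_. x"]) simp
next
  case (Suc N)
  then obtain \<omega> where \<omega>: "\<And>s. \<omega> s \<in> \<Omega>"
    "(\<Sum>e\<in>E. 2 ^ card {s. s < N \<and> \<omega> s \<in> bad e}) \<le> real (card E) * (1 + p) ^ N"
    by blast
  define c where "c e = (2::real) ^ card {s. s < N \<and> \<omega> s \<in> bad e}" for e
  have sum_c: "(\<Sum>e\<in>E. c e) \<le> real (card E) * (1 + p) ^ N"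
    using \<omega>(2) by (simp add: c_def)
  \<comment> \<open>\<open>F x\<close> is the potential after choosing \<open>x\<close> next: a bad
    \<open>x\<close> doubles the term of \<open>e\<close>. Its average over \<open>x\<close> stays
    within the bound.\<close>
  define F where "F x = (\<Sum>e\<in>E. c e * (1 + (if x \<in> bad e then 1 else 0)))" for x
  have "(\<Sum>x\<in>\<Omega>. F x)
      = (\<Sum>e\<in>E. c e * (real (card \<Omega>) + real (card {x \<in> \<Omega>. x \<in> bad e})))"
    unfolding F_def using assms(1)
    by (subst sum.swap)
      (simp add: sum_distrib_left[symmetric] sum.distrib sum.inter_filter[symmetric])
  also have "\<dots> \<le> (\<Sum>e\<in>E. c e * (real (card \<Omega>) + p * real (card \<Omega>)))"
    using bad by (intro sum_mono mult_left_mono add_left_mono) (auto simp: c_def)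
  also have "\<dots> = (\<Sum>e\<in>E. c e) * ((1 + p) * real (card \<Omega>))"
    unfolding sum_distrib_right by (intro sum.cong) (auto simp: algebra_simps)
  also have "\<dots> \<le> (real (card E) * (1 + p) ^ N) * ((1 + p) * real (card \<Omega>))"
    using sum_c assms(5) by (intro mult_right_mono) auto
  also have "\<dots> = (\<Sum>x\<in>\<Omega>. real (card E) * (1 + p) ^ Suc N)"
    by (simp add: algebra_simps)
  finally have "\<not> (\<forall>x\<in>\<Omega>. F x > real (card E) * (1 + p) ^ Suc N)"
    using sum_strict_mono[OF assms(1,2), of "\<lambda>_. real (card E) * (1 + p) ^ Suc N" F] by force
  then obtain x where x: "x \<in> \<Omega>" "F x \<le> real (card E) * (1 + p) ^ Suc N"
    by (auto simp: not_less)
  define \<omega>' where "\<omega>' s = (if s = N then x else \<omega> s)" for s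
  have "2 ^ card {s. s < Suc N \<and> \<omega>' s \<in> bad e} = c e * (1 + (if x \<in> bad e then 1 else 0))" for e
  proof -
    have "{s. s < Suc N \<and> \<omega>' s \<in> bad e}
        = (if x \<in> bad e then {N} else {}) \<union> {s. s < N \<and> \<omega> s \<in> bad e}"
      by (auto simp: \<omega>'_def less_Suc_eq)
    moreover have "card ({N} \<union> {s. s < N \<and> \<omega> s \<in> bad e})
        = Suc (card {s. s < N \<and> \<omega> s \<in> bad e})"
      by (simp add: card_insert_if)
    ultimately show ?thesis
      by (simp add: c_def)
  qed
  then have "(\<Sum>e\<in>E. 2 ^ card {s. s < Suc N \<and> \<omega>' s \<in> bad e}) \<le> real (card E) * (1 + p) ^ Suc N"
    using x(2) by (simp add: F_def)
  moreover have "\<forall>s. \<omega>' s \<in> \<Omega>"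
    using \<omega>(1) x(1) by (simp add: \<omega>'_def)
  ultimately show ?case
    by blast
qed

text \<open>The derandomisation is applied to the pairs \<open>(U, J)\<close> whose union bound is
  at most \<open>p = (1/2) ^ b\<close>, over \<open>2 ^ b\<close> rounds. The growth factor is then
  at most e, and each single term is below the whole potential. Taking logarithms leaves a number of
  bad seeds linear in \<open>card I\<close>, whatever \<open>b\<close> is.\<close>

lemma exists_columns_few_bad:
  fixes G :: "'i \<Rightarrow> 'c set" and \<J> :: "'c set set"
  assumes fin: "finite I" "\<And>i. i \<in> I \<Longrightarrow> finite (G i)" "finite \<J>" "\<forall>J\<in>\<J>. finite J"
  shows "\<exists>col. (\<forall>s. \<forall>i\<in>I. col s i \<subseteq> G i) \<and>
    (\<forall>U J. U \<subseteq> I \<longrightarrow> J \<in> \<J> \<longrightarrow>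
      (\<Sum>B\<in>Pow J - {{}}. (1/2) ^ card {i \<in> U. B \<inter> G i \<noteq> {}}) \<le> (1/2 :: real) ^ b \<longrightarrow>
      2 ^ card {s :: nat. s < 2 ^ b \<and> annihilated (col s) U J} \<le> 4 * 2 ^ card I * card \<J>)"
proof -
  define \<Omega> where "\<Omega> = Pi\<^sub>E I (\<lambda>i. Pow (G i))"
  define E where "E = {(U, J). U \<in> Pow I \<and> J \<in> \<J> \<and>
    (\<Sum>B\<in>Pow J - {{}}. (1/2) ^ card {i \<in> U. B \<inter> G i \<noteq> {}}) \<le> (1/2 :: real) ^ b}"
  define bad where "bad e = {\<omega>. annihilated \<omega> (fst e) (snd e)}" for e :: "'i set \<times> 'c set"
  have E: "E \<subseteq> Pow I \<times> \<J>"
    by (auto simp: E_def)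
  have "finite E"
    by (rule finite_subset[OF E]) (use fin in auto)
  have "card E \<le> card (Pow I \<times> \<J>)"
    by (rule card_mono[OF _ E]) (use fin in auto)
  then have card_E: "real (card E) \<le> real (2 ^ card I * card \<J>)"
    unfolding of_nat_le_iff by (simp add: card_cartesian_product card_Pow fin(1))
  have "finite \<Omega>" "\<Omega> \<noteq> {}"
    using fin by (auto simp: \<Omega>_def intro!: finite_PiE simp: PiE_eq_empty_iff)
  moreover have "real (card {x \<in> \<Omega>. x \<in> bad e}) \<le> (1/2) ^ b * real (card \<Omega>)" if "e \<in> E" for e
  proof -
    have "real (card {x \<in> \<Omega>. x \<in> bad e}) \<le> real (card \<Omega>)
        * (\<Sum>B\<in>Pow (snd e) - {{}}. (1/2) ^ card {i \<in> fst e. B \<inter> G i \<noteq> {}})"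
      using that fin card_annihilated[of I G "snd e" "fst e"]
      by (auto simp: \<Omega>_def bad_def E_def)
    also have "\<dots> \<le> real (card \<Omega>) * (1/2) ^ b"
      using that by (intro mult_left_mono) (auto simp: E_def)
    finally show ?thesis
      by (simp add: mult.commute)
  qed
  ultimately obtain col where col: "\<And>s. col s \<in> \<Omega>"
    "(\<Sum>e\<in>E. 2 ^ card {s :: nat. s < 2 ^ b \<and> col s \<in> bad e}) \<le> real (card E) * (1 + (1/2) ^ b) ^ (2 ^ b)"
    using exists_sequence_few_bad[of \<Omega> E bad "(1/2) ^ b" "2 ^ b"] \<open>finite E\<close> by auto
  \<comment> \<open>e is rounded up to 4, a power of two, so that the final count can be read off as
    an exponent.\<close>
  have "(1 + (1/2) ^ b) ^ (2 ^ b) \<le> exp (1::real)"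
    using exp_ge_one_plus_x_over_n_power_n[of "2 ^ b" 1] order_trans[of "- 1" 0 "2 ^ b :: real"]
    by (simp add: power_one_over)
  also have "\<dots> \<le> 4"
    using exp_le by simp
  finally have e4: "(1 + (1/2) ^ b) ^ (2 ^ b) \<le> (4::real)" .
  have "2 ^ card {s. s < 2 ^ b \<and> annihilated (col s) U J} \<le> 4 * 2 ^ card I * card \<J>"
    if "U \<subseteq> I" "J \<in> \<J>"
      "(\<Sum>B\<in>Pow J - {{}}. (1/2) ^ card {i \<in> U. B \<inter> G i \<noteq> {}}) \<le> (1/2 :: real) ^ b" for U J
  proof -
    have UJ: "(U, J) \<in> E"
      using that by (simp add: E_def)
    have "(2 :: real) ^ card {s. s < 2 ^ b \<and> annihilated (col s) U J}
        = 2 ^ card {s. s < 2 ^ b \<and> col s \<in> bad (U, J)}"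
      by (simp add: bad_def)
    also have "\<dots> \<le> (\<Sum>e\<in>E. 2 ^ card {s. s < 2 ^ b \<and> col s \<in> bad e})"
      by (rule member_le_sum[OF UJ]) (use \<open>finite E\<close> in auto)
    also have "\<dots> \<le> real (card E) * (1 + (1/2) ^ b) ^ (2 ^ b)"
      by (rule col(2))
    also have "\<dots> \<le> real (2 ^ card I * card \<J>) * 4"
      using card_E e4 by (intro mult_mono) auto
    finally have "real (2 ^ card {s. s < 2 ^ b \<and> annihilated (col s) U J})
        \<le> real (4 * 2 ^ card I * card \<J>)"
      by (simp add: algebra_simps)
    then show ?thesis
      unfolding of_nat_le_iff .
  qed
  then show ?thesis
    using col(1) by (intro exI[of _ col]) (auto simp: \<Omega>_def PiE_iff)
qed

section \<open>Bounds on mutual information\<close>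

text \<open>Gibbs' inequality, from ln t <= t - 1. It supplies the lower half of the squeeze for the
  leakage.\<close>

lemma mutual_info_nonneg:
  assumes fin: "finite (set_pmf p)"
  shows "0 \<le> mutual_info p"
proof -
  define A where "A = fst ` set_pmf p"
  define B where "B = snd ` set_pmf p"
  let ?q = "\<lambda>(a, b). pmf (map_pmf fst p) a * pmf (map_pmf snd p) b"
  have "(\<Sum>x\<in>set_pmf p. ?q x) \<le> (\<Sum>x\<in>A \<times> B. ?q x)"
    using fin by (intro sum_mono2) (auto simp: A_def B_def intro: rev_image_eqI)
  also have "\<dots> = (\<Sum>a\<in>A. pmf (map_pmf fst p) a) * (\<Sum>b\<in>B. pmf (map_pmf snd p) b)"
    by (simp add: sum_product sum.cartesian_product)
  also have "\<dots> = 1"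
    using fin by (simp add: A_def B_def sum_pmf_eq_1)
  finally have q: "(\<Sum>x\<in>set_pmf p. ?q x) \<le> 1" .
  have "0 \<le> (\<Sum>x\<in>set_pmf p. (pmf p x - ?q x) / ln 2)"
    using q fin by (simp add: sum_divide_distrib[symmetric] sum_subtractf sum_pmf_eq_1)
  also have "\<dots> \<le> mutual_info p"
    unfolding mutual_info_def
  proof (intro sum_mono)
    fix x assume x: "x \<in> set_pmf p"
    obtain a b where ab: "x = (a, b)"
      by (cases x)
    have pos: "pmf p (a, b) > 0" "pmf (map_pmf fst p) a > 0" "pmf (map_pmf snd p) b > 0"
      using x ab by (auto simp: pmf_positive_iff intro: rev_image_eqI)
    define r where "r = pmf (map_pmf fst p) a * pmf (map_pmf snd p) b"
    have r: "r > 0"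
      using pos by (simp add: r_def)
    have "ln (r / pmf p (a, b)) \<le> r / pmf p (a, b) - 1"
      using pos r by (intro ln_le_minus_one) auto
    then have "1 - r / pmf p (a, b) \<le> ln (pmf p (a, b) / r)"
      using pos r by (simp add: ln_div)
    then have "pmf p (a, b) * (1 - r / pmf p (a, b)) \<le> pmf p (a, b) * ln (pmf p (a, b) / r)"
      using pos by (intro mult_left_mono) auto
    then have "pmf p (a, b) - r \<le> pmf p (a, b) * ln (pmf p (a, b) / r)"
      using pos by (simp add: right_diff_distrib)
    then show "(pmf p x - ?q x) / ln 2 \<le> (case x of (a, b) \<Rightarrow>
        pmf p (a, b) * log 2 (pmf p (a, b) / (pmf (map_pmf fst p) a * pmf (map_pmf snd p) b)))"
      by (simp add: ab r_def log_def divide_right_mono)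
  qed
  finally show ?thesis .
qed

text \<open>The log-sum inequality for the pairs (g, h) and (g, h/K): the \<open>g\<close> terms
  contribute log 1 = 0. It comes from convexity of exp between 0 and - ln K with weight h/(g +
  h).\<close>

lemma two_term_log_sum:
  fixes g h K :: real
  assumes "0 \<le> g" "0 \<le> h" "0 < g + h" "1 \<le> K"
  shows "(g + h) * log 2 ((g + h) / (g + h / K)) \<le> h * log 2 K"
proof -
  define t where "t = h / (g + h)"
  have t: "0 \<le> t" "t \<le> 1"
    using assms by (auto simp: t_def field_simps)
  have "exp (1 * ((1 - t) *\<^sub>R 0 + t *\<^sub>R (- ln K))) \<le> (1 - t) * exp (1 * 0) + t * exp (1 * (- ln K))"
    using t by (intro convex_onD[OF convex_on_exp]) auto
  then have "exp (- (t * ln K)) \<le> (1 - t) + t / K"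
    using assms by (simp add: exp_minus field_simps)
  moreover have "(1 - t) + t / K = (g + h / K) / (g + h)"
  proof -
    have "1 - t = g / (g + h)"
      using assms by (simp add: t_def field_simps)
    then show ?thesis
      by (simp add: t_def add_divide_distrib)
  qed
  ultimately have "- (t * ln K) \<le> ln ((g + h / K) / (g + h))"
    by (metis exp_gt_zero ln_exp ln_le_cancel_iff order_less_le_trans)
  moreover have "g + h / K > 0"
    using assms by (cases "h = 0") (auto intro: add_nonneg_pos)
  ultimately have "ln ((g + h) / (g + h / K)) \<le> t * ln K"
    using assms by (simp add: ln_div)
  then have "(g + h) * ln ((g + h) / (g + h / K)) \<le> (g + h) * (t * ln K)"
    using assms by (intro mult_left_mono) auto
  also have "\<dots> = h * ln K"
    using assms by (simp add: t_def)
  finally show ?thesis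
    by (simp add: log_def divide_right_mono)
qed

text \<open>Outside \<open>B\<close> the observation carries no information about the message, and on \<open>B\<close> it
  reveals at most the whole message.\<close>

lemma mutual_info_le:
  fixes Z :: "'w \<Rightarrow> 'u \<Rightarrow> 'z" and Q :: "'u pmf"
  assumes W: "finite W" "W \<noteq> {}" and Q: "finite (set_pmf Q)"
    and indep: "\<And>w w' z. w \<in> W \<Longrightarrow> w' \<in> W \<Longrightarrow>
      measure_pmf.prob Q {u. u \<notin> B \<and> Z w u = z} = measure_pmf.prob Q {u. u \<notin> B \<and> Z w' u = z}"
  shows "mutual_info (map_pmf (\<lambda>(w, u). (w, Z w u)) (pair_pmf (pmf_of_set W) Q))
    \<le> measure_pmf.prob Q B * log 2 (real (card W))"
proof -
  define K where "K = real (card W)"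
  have K: "K \<ge> 1"
    using W by (simp add: K_def Suc_le_eq card_gt_0_iff)
  define p where "p = map_pmf (\<lambda>(w, u). (w, Z w u)) (pair_pmf (pmf_of_set W) Q)"
  define q where "q w z = pmf (map_pmf (Z w) Q) z" for w z
  define g where "g w z = measure_pmf.prob Q {u. u \<notin> B \<and> Z w u = z}" for w z
  define h where "h w z = measure_pmf.prob Q {u. u \<in> B \<and> Z w u = z}" for w z
  define R where "R = (\<Union>w\<in>W. Z w ` set_pmf Q)"
  have q_split: "q w z = g w z + h w z" for w z
  proof -
    have "q w z = measure_pmf.prob Q ({u. u \<notin> B \<and> Z w u = z} \<union> {u. u \<in> B \<and> Z w u = z})"
      unfolding q_def pmf_map by (rule arg_cong[where f = "measure_pmf.prob Q"]) auto
    then show ?thesis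
      unfolding g_def h_def by (subst (asm) measure_pmf.finite_measure_Union) auto
  qed
  have nonneg: "g w z \<ge> 0" "h w z \<ge> 0" for w z
    by (simp_all add: g_def h_def)
  have p_bind: "p = bind_pmf (pmf_of_set W) (\<lambda>w. map_pmf (\<lambda>u. (w, Z w u)) Q)"
    by (simp add: p_def pair_pmf_def map_bind_pmf map_pmf_def bind_assoc_pmf bind_return_pmf)
  have "pmf (map_pmf (\<lambda>u. (w', Z w' u)) Q) (w, z) = (if w' = w then q w z else 0)" for w' w z
  proof (cases "w' = w")
    case True
    then show ?thesis
      by (simp add: q_def pmf_map) (rule arg_cong[where f = "measure_pmf.prob Q"], auto)
  next
    case False
    then show ?thesis
      by (auto simp: pmf_eq_0_set_pmf)
  qed
  then have pmf_p: "pmf p (w, z) = q w z / K" if "w \<in> W" for w z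
    using W that by (simp add: p_bind pmf_bind_pmf_of_set K_def)
  have fst_p: "map_pmf fst p = pmf_of_set W"
    by (simp add: p_bind map_bind_pmf pmf.map_comp o_def map_pmf_const bind_return_pmf')
  have snd_p: "map_pmf snd p = bind_pmf (pmf_of_set W) (\<lambda>w. map_pmf (Z w) Q)"
    by (simp add: p_bind map_bind_pmf pmf.map_comp o_def)
  \<comment> \<open>The law of \<open>z\<close> averages over all messages. The \<open>g\<close>
    parts agree by independence; of the \<open>h\<close> parts only that of \<open>w\<close> itself
    is kept, with weight 1/K.\<close>
  have pmf_snd: "pmf (map_pmf snd p) z \<ge> g w z + h w z / K" if "w \<in> W" for w z
  proof -
    have "K * g w z + h w z = (\<Sum>w'\<in>W. g w z) + (\<Sum>w'\<in>{w}. h w' z)"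
      by (simp add: K_def)
    also have "\<dots> \<le> (\<Sum>w'\<in>W. g w' z) + (\<Sum>w'\<in>W. h w' z)"
    proof (rule add_mono)
      have "g w z = g w' z" if "w' \<in> W" for w'
        unfolding g_def by (rule indep[OF \<open>w \<in> W\<close> that])
      then show "(\<Sum>w'\<in>W. g w z) \<le> (\<Sum>w'\<in>W. g w' z)"
        by (intro sum_mono) simp
      show "(\<Sum>w'\<in>{w}. h w' z) \<le> (\<Sum>w'\<in>W. h w' z)"
        using W that nonneg by (intro sum_mono2) auto
    qed
    also have "\<dots> = K * pmf (map_pmf snd p) z"
      using W K by (simp add: snd_p pmf_bind_pmf_of_set K_def q_def[symmetric] q_split sum.distrib)
    finally show ?thesis
      using K by (simp add: field_simps)
  qed
  have set_p: "set_pmf p \<subseteq> W \<times> R"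
    using W by (auto simp: p_def R_def)
  have fin_R: "finite R"
    using W Q by (auto simp: R_def)
  have "mutual_info p \<le> (\<Sum>x\<in>set_pmf p. case x of (w, z) \<Rightarrow> h w z / K * log 2 K)"
    unfolding mutual_info_def
  proof (intro sum_mono)
    fix x assume x: "x \<in> set_pmf p"
    obtain w z where wz: "x = (w, z)"
      by (cases x)
    have w: "w \<in> W"
      using x wz set_p by auto
    have "q w z > 0"
      using x wz pmf_p[OF w, of z] K by (simp add: pmf_positive_iff[symmetric] zero_less_divide_iff)
    then have gh: "g w z + h w z > 0"
      by (simp add: q_split)
    have low: "g w z + h w z / K > 0"
      using gh K nonneg[of w z] by (cases "h w z = 0") (auto intro: add_nonneg_pos)
    have pos: "pmf (map_pmf snd p) z > 0"
      using pmf_snd[OF w, of z] low by linarith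
    have "pmf p (w, z) / (pmf (map_pmf fst p) w * pmf (map_pmf snd p) z)
        = (g w z + h w z) / pmf (map_pmf snd p) z"
      using W w K by (simp add: pmf_p fst_p q_split K_def)
    moreover have "\<dots> \<le> (g w z + h w z) / (g w z + h w z / K)"
      using pmf_snd[OF w] low gh pos by (intro divide_left_mono) (auto intro!: mult_pos_pos)
    ultimately have "log 2 (pmf p (w, z) / (pmf (map_pmf fst p) w * pmf (map_pmf snd p) z))
        \<le> log 2 ((g w z + h w z) / (g w z + h w z / K))"
      using gh low pos by (auto intro!: divide_pos_pos)
    then have "(g w z + h w z) * log 2 (pmf p (w, z) / (pmf (map_pmf fst p) w * pmf (map_pmf snd p) z))
        \<le> (g w z + h w z) * log 2 ((g w z + h w z) / (g w z + h w z / K))"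
      using gh by (intro mult_left_mono) auto
    also have "\<dots> \<le> h w z * log 2 K"
      using gh nonneg K by (intro two_term_log_sum) auto
    finally have "(g w z + h w z) * log 2 (pmf p (w, z) / (pmf (map_pmf fst p) w * pmf (map_pmf snd p) z)) / K
        \<le> h w z * log 2 K / K"
      using K by (intro divide_right_mono) auto
    then show "(case x of (w, z) \<Rightarrow>
        pmf p (w, z) * log 2 (pmf p (w, z) / (pmf (map_pmf fst p) w * pmf (map_pmf snd p) z)))
        \<le> (case x of (w, z) \<Rightarrow> h w z / K * log 2 K)"
      by (simp add: wz pmf_p[OF w] q_split)
  qed
  also have "\<dots> \<le> (\<Sum>x\<in>W \<times> R. case x of (w, z) \<Rightarrow> h w z / K * log 2 K)"
    using W fin_R set_p K nonneg by (intro sum_mono2) auto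
  also have "\<dots> = (\<Sum>w\<in>W. (\<Sum>z\<in>R. h w z) * (log 2 K / K))"
    by (simp add: sum.cartesian_product[symmetric] sum_distrib_right sum_divide_distrib)
  also have "\<dots> \<le> (\<Sum>w\<in>W. measure_pmf.prob Q B * (log 2 K / K))"
  proof (intro sum_mono mult_right_mono)
    fix w
    have "(\<Sum>z\<in>R. h w z) = measure_pmf.prob Q (\<Union>z\<in>R. {u. u \<in> B \<and> Z w u = z})"
      unfolding h_def using fin_R
      by (intro measure_pmf.finite_measure_finite_Union[symmetric]) (auto simp: disjoint_family_on_def)
    also have "\<dots> \<le> measure_pmf.prob Q B"
      by (intro measure_pmf.finite_measure_mono) auto
    finally show "(\<Sum>z\<in>R. h w z) \<le> measure_pmf.prob Q B" .
  qed (use K in auto)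
  also have "\<dots> = measure_pmf.prob Q B * log 2 K"
    using K by (simp add: K_def)
  finally show ?thesis
    by (simp add: p_def K_def)
qed

section \<open>The coding scheme\<close>

text \<open>The bits at \<open>Cached j l i\<close> form the part of file \<open>l\<close> stored at receiver \<open>j\<close>, the
  bits at \<open>Common i\<close> the XOR of the two parts each receiver misses of its own file, and those at
  \<open>Private j i\<close> the uncached rest of the file receiver \<open>j\<close> asks for.\<close>

datatype coord = Cached nat nat nat | Common nat | Private nat nat

definition cached_coords :: "nat \<Rightarrow> nat \<Rightarrow> coord set" where
  "cached_coords D p = {Cached j l i | j l i. j < 2 \<and> l < D \<and> i < p}"

definition delivery_coords :: "nat \<Rightarrow> nat \<Rightarrow> coord set" where
  "delivery_coords p r = {Common i | i. i < p} \<union> {Private j i | j i. j < 2 \<and> i < r}"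

text \<open>The keys reuse the constructor \<open>Private\<close> of the delivery coordinates, so
  that key and masked bit add up in the same coordinate.\<close>

definition key_coords :: "nat \<Rightarrow> coord set" where
  "key_coords q = {Private j i | j i. j < 2 \<and> i < q}"

definition receiver_coords :: "nat \<Rightarrow> nat \<Rightarrow> nat \<Rightarrow> nat \<Rightarrow> coord set" where
  "receiver_coords D p q j = {Cached j l i | l i. l < D \<and> i < p} \<union> {Private j i | i. i < q}"

text \<open>Channel positions are pairs of a phase (\<^const>\<open>False\<close> for placement, \<^const>\<open>True\<close> for
  delivery) and an index; \<open>col s\<close> assigns to each of them, for the seed \<open>s\<close>, a column of the
  linear map that computes the secret bits from the channel inputs.\<close>

definition column_coords :: "nat \<Rightarrow> nat \<Rightarrow> nat \<Rightarrow> nat \<Rightarrow> bool \<times> nat \<Rightarrow> coord set" where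
  "column_coords D p q r x =
     (if fst x then delivery_coords p r else cached_coords D p \<union> key_coords q)"

text \<open>The coordinates prescribed when phase \<open>t\<close> is encoded. Those of the keys are
  left free during placement, which makes them random pads.\<close>

definition phase_coords :: "nat \<Rightarrow> nat \<Rightarrow> nat \<Rightarrow> bool \<Rightarrow> coord set" where
  "phase_coords D p r t = (if t then delivery_coords p r else cached_coords D p)"

definition slots :: "nat \<Rightarrow> bool \<Rightarrow> (bool \<times> nat) set" where
  "slots m t = {t} \<times> {..<m}"

text \<open>Here \<open>L0\<close> is the syndrome of the random word, \<open>L1\<close> that of its
  correction and \<open>R\<close> the contribution of the earlier phase.\<close>

lemma sym_diff_correction:
  assumes "T \<subseteq> K" "L1 \<inter> K = sym_diff T (sym_diff R L0) \<inter> K" "L = sym_diff L0 L1"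
  shows "sym_diff R L \<inter> K = T"
  using assms by blast

text \<open>If the prescribed bits and the syndrome of the random word change by the same amount,
  the correction to be solved for is unchanged.\<close>

lemma sym_diff_shift:
  assumes "B \<subseteq> K" "B' \<subseteq> K" "L \<inter> K = sym_diff B B'"
  shows "sym_diff B' (sym_diff X L) \<inter> K = sym_diff B X \<inter> K"
  using assms by blast

lemma sym_diff_shift2:
  assumes "B \<subseteq> K" "B' \<subseteq> K" "sym_diff L1 L2 \<inter> K = sym_diff B B'"
  shows "sym_diff B' (sym_diff (sym_diff X L1) (sym_diff Y L2)) \<inter> K
    = sym_diff B (sym_diff X Y) \<inter> K"
proof -
  have "sym_diff (sym_diff X L1) (sym_diff Y L2) = sym_diff (sym_diff X Y) (sym_diff L1 L2)"
    by blast
  then show ?thesis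
    using sym_diff_shift[OF assms] by simp
qed

lemma sym_diff_Int_right:
  "sym_diff (sym_diff P A \<inter> S) X = sym_diff (sym_diff (P \<inter> S) X) (A \<inter> S)"
  by blast

lemma sym_diff_components:
  assumes "L \<inter> (C \<union> E) = sym_diff (c \<union> d) (c' \<union> d')"
    and "c \<subseteq> C" "c' \<subseteq> C" "d \<subseteq> E" "d' \<subseteq> E" "C \<inter> E = {}"
  shows "L \<inter> C = sym_diff c c'" "L \<inter> E = sym_diff d d'"
  using assms by blast+

lemma finite_slots [simp]: "finite (slots m t)"
  by (simp add: slots_def)

text \<open>The encodings enter as arbitrary injections, since cardinality alone provides them.
  \<open>rand\<close> unpacks the private randomness into a seed and a random word over both
  phases.\<close>

locale caching_scheme =
  fixes D n b p q r M :: nat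
    and col :: "nat \<Rightarrow> bool \<times> nat \<Rightarrow> coord set"
    and file_bits seed_bits :: "nat \<Rightarrow> nat set"
    and cache_index :: "nat \<Rightarrow> coord set \<Rightarrow> nat"
    and rand :: "nat \<Rightarrow> nat \<times> (bool \<times> nat) set"
  assumes b_le: "b \<le> n" and q_le: "q \<le> r"
    and M_pos: "M > 0"
    and inj_file: "inj_on file_bits {..<M}"
    and file_bits: "\<And>x. x < M \<Longrightarrow> file_bits x \<subseteq> {..<2 * p + r}"
    and inj_seed: "inj_on seed_bits {..<2 ^ b}"
    and seed_bits: "\<And>s. s < 2 ^ b \<Longrightarrow> seed_bits s \<subseteq> {n - b..<n}"
    and inj_cache: "\<And>j. j < 2 \<Longrightarrow> inj_on (cache_index j) (Pow (receiver_coords D p q j))"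
    and cache_index: "\<And>j T. j < 2 \<Longrightarrow> T \<subseteq> receiver_coords D p q j \<Longrightarrow>
      cache_index j T < 2 ^ (n div 2)"
    and rand: "bij_betw rand {..<2 ^ b * 2 ^ (2 * (n - b))} ({..<2 ^ b} \<times> Pow (UNIV \<times> {..<n - b}))"
    and col: "\<And>s x. snd x < n - b \<Longrightarrow> col s x \<subseteq> column_coords D p q r x"
begin

text \<open>A file consists of three blocks: \<open>p\<close> bits cached by receiver 0,
  \<open>p\<close> bits cached by receiver 1, and \<open>r\<close> uncached bits from position
  \<open>2 * p\<close> on.\<close>

definition cached_bits :: "(nat \<Rightarrow> nat) \<Rightarrow> coord set" where
  "cached_bits w = {Cached j l i | j l i. j < 2 \<and> l < D \<and> i < p \<and> j * p + i \<in> file_bits (w l)}"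

text \<open>Receiver 0 misses the second block of its file and receiver 1 the first block of its
  own. Each has cached what the other misses, so one XOR serves both.\<close>

definition delivered_bits :: "nat \<times> nat \<Rightarrow> (nat \<Rightarrow> nat) \<Rightarrow> coord set" where
  "delivered_bits d w =
     {Common i | i. i < p \<and> (p + i \<in> file_bits (w (fst d))) \<noteq> (i \<in> file_bits (w (snd d)))} \<union>
     {Private j i | j i. j < 2 \<and> i < r \<and> 2 * p + i \<in> file_bits (w (demand d j))}"

text \<open>The intersection keeps the value inside the slots even if the system has no solution and
  the choice is arbitrary.\<close>

definition preimage :: "nat \<Rightarrow> bool \<Rightarrow> coord set \<Rightarrow> (bool \<times> nat) set" where
  "preimage s t T = slots (n - b) t \<inter>
     (SOME X. X \<subseteq> slots (n - b) t \<and> lin (col s) X \<inter> phase_coords D p r t = T)"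

text \<open>A uniform word plus a correction that depends only on its syndrome is a uniform
  solution, whenever the system is solvable.\<close>

definition placement :: "nat \<Rightarrow> (nat \<Rightarrow> nat) \<Rightarrow> (bool \<times> nat) set \<Rightarrow> (bool \<times> nat) set" where
  "placement s w P = (let X = P \<inter> slots (n - b) False in
     sym_diff X (preimage s False (sym_diff (cached_bits w) (lin (col s) X) \<inter> cached_coords D p)))"

text \<open>The syndrome of the placement word enters the target because the prescribed bits are
  parities over both codewords.\<close>

definition delivery ::
    "nat \<Rightarrow> nat \<times> nat \<Rightarrow> (nat \<Rightarrow> nat) \<Rightarrow> (bool \<times> nat) set \<Rightarrow> (bool \<times> nat) set" where
  "delivery s d w P = (let Y = P \<inter> slots (n - b) True in
     sym_diff Y (preimage s True (sym_diff (delivered_bits d w)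
       (sym_diff (lin (col s) (placement s w P)) (lin (col s) Y)) \<inter> delivery_coords p r)))"

text \<open>The seed occupies the last \<open>b\<close> positions of both codewords, so that the
  cache function and the decoder can each read it. It is independent of the files, so tapping it is
  harmless.\<close>

definition word :: "bool \<Rightarrow> nat \<Rightarrow> (bool \<times> nat) set \<Rightarrow> bool list" where
  "word t s X = map (\<lambda>i. if i < n - b then (t, i) \<in> X else i \<in> seed_bits s) [0..<n]"

definition seed_of :: "bool list \<Rightarrow> nat" where
  "seed_of x = (SOME s. s < 2 ^ b \<and> (\<forall>i\<in>{n - b..<n}. x ! i \<longleftrightarrow> i \<in> seed_bits s))"

definition body_of :: "bool \<Rightarrow> bool list \<Rightarrow> (bool \<times> nat) set" where
  "body_of t x = {(t, i) | i. i < n - b \<and> x ! i}"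

definition cache_content :: "nat \<Rightarrow> bool list \<Rightarrow> coord set" where
  "cache_content j x = lin (col (seed_of x)) (body_of False x) \<inter> receiver_coords D p q j"

definition recovered_bits :: "nat \<times> nat \<Rightarrow> nat \<Rightarrow> coord set \<Rightarrow> coord set \<Rightarrow> nat set" where
  "recovered_bits d j C V =
     {j * p + i | i. i < p \<and> Cached j (demand d j) i \<in> C} \<union>
     {(1 - j) * p + i | i. i < p \<and> (Common i \<in> V) \<noteq> (Cached j (demand d (1 - j)) i \<in> C)} \<union>
     {2 * p + i | i. i < r \<and> Private j i \<in> V}"

text \<open>Adding \<open>C\<close> removes the keys of receiver \<open>j\<close>. It also leaves
  \<open>Cached\<close> coordinates in the sum, but \<open>recovered_bits\<close> reads only
  \<open>Common\<close> and \<open>Private\<close> ones from there.\<close>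

definition decoder :: "nat \<times> nat \<Rightarrow> nat \<Rightarrow> nat \<Rightarrow> bool list \<Rightarrow> nat" where
  "decoder d j k y =
     (let C = inv_into (Pow (receiver_coords D p q j)) (cache_index j) k in
      inv_into {..<M} file_bits
        (recovered_bits d j C (sym_diff (lin (col (seed_of y)) (body_of True y)) C)))"

definition code :: cbc_code where
  "code = \<lparr>
     enc_c = \<lambda>w u. word False (fst (rand u)) (placement (fst (rand u)) w (snd (rand u))),
     cache = \<lambda>j x. if j < 2 then cache_index j (cache_content j x) else 0,
     enc_d = \<lambda>d w u. word True (fst (rand u)) (delivery (fst (rand u)) d w (snd (rand u))),
     dec = decoder,
     rnd = pmf_of_set {..<2 ^ b * 2 ^ (2 * (n - b))}\<rparr>"

section \<open>Validity and correctness of the code\<close>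

lemma finite_body: "X \<subseteq> UNIV \<times> {..<n - b} \<Longrightarrow> finite (X :: (bool \<times> nat) set)"
  by (rule finite_subset) auto

lemma valid_code: "valid_code n code"
proof -
  have "real (cache code j x) + 1 \<le> 2 powr (real n / 2)" if "j < 2" for j x
  proof -
    have "cache_index j (cache_content j x) < 2 ^ (n div 2)"
      using that by (intro cache_index) (auto simp: cache_content_def)
    then have "real (cache code j x) + 1 \<le> real (2 ^ (n div 2))"
      using that by (simp add: code_def del: of_nat_power flip: of_nat_Suc)
    also have "\<dots> = 2 powr real (n div 2)"
      by (simp add: powr_realpow)
    also have "\<dots> \<le> 2 powr (real n / 2)"
      by (intro powr_mono) linarith+
    finally show ?thesis .
  qed
  moreover have "finite (set_pmf (rnd code))"
    by (simp add: code_def set_pmf_of_set lessThan_empty_iff)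
  ultimately show ?thesis
    by (simp add: valid_code_def code_def word_def)
qed

lemma preimage_subset: "preimage s t T \<subseteq> slots (n - b) t"
  by (auto simp: preimage_def)

lemma placement_subset: "placement s w P \<subseteq> slots (n - b) False"
  using preimage_subset by (auto simp: placement_def Let_def)

lemma delivery_subset: "delivery s d w P \<subseteq> slots (n - b) True"
  using preimage_subset by (auto simp: delivery_def Let_def)

lemma finite_placement: "finite (placement s w P)"
  by (rule finite_subset[OF placement_subset]) simp

lemma lin_preimage:
  assumes "\<not> annihilated (col s) (slots (n - b) t) (phase_coords D p r t)"
    and "finite (phase_coords D p r t)" and "T \<subseteq> phase_coords D p r t"
  shows "lin (col s) (preimage s t T) \<inter> phase_coords D p r t = T"
proof -
  have "\<exists>X. X \<subseteq> slots (n - b) t \<and> lin (col s) X \<inter> phase_coords D p r t = T"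
    using lin_surj[OF _ assms(2,1,3)] by simp
  then have *: "(SOME X. X \<subseteq> slots (n - b) t \<and> lin (col s) X \<inter> phase_coords D p r t = T)
      \<subseteq> slots (n - b) t \<and>
      lin (col s) (SOME X. X \<subseteq> slots (n - b) t \<and> lin (col s) X \<inter> phase_coords D p r t = T)
        \<inter> phase_coords D p r t = T"
    by (rule someI_ex)
  then show ?thesis
    unfolding preimage_def by (simp add: Int_absorb1)
qed

lemma seed_of_word:
  assumes "s < 2 ^ b"
  shows "seed_of (word t s X) = s"
proof -
  have *: "word t s X ! i \<longleftrightarrow> i \<in> seed_bits s" if "i \<in> {n - b..<n}" for i
    using that by (simp add: word_def)
  have "s' = s" if "s' < 2 ^ b" "\<forall>i\<in>{n - b..<n}. i \<in> seed_bits s \<longleftrightarrow> i \<in> seed_bits s'" for s'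
  proof (rule inj_onD[OF inj_seed])
    show "seed_bits s' = seed_bits s"
      using that seed_bits[OF assms] seed_bits[OF that(1)] by blast
  qed (use that assms in auto)
  then show ?thesis
    unfolding seed_of_def using * assms by (intro some_equality) auto
qed

lemma body_of_word:
  assumes "X \<subseteq> slots (n - b) t"
  shows "body_of t (word t s X) = X"
proof -
  have "word t s X ! i \<longleftrightarrow> (t, i) \<in> X" if "i < n - b" for i
    using that by (simp add: word_def)
  then have "body_of t (word t s X) = {(t, i) | i. i < n - b \<and> (t, i) \<in> X}"
    by (auto simp: body_of_def)
  also have "\<dots> = X"
    using assms by (fastforce simp: slots_def)
  finally show ?thesis .
qed

text \<open>For a good seed both linear systems are solvable, so the two codewords carry exactly the
  prescribed parities and each block of the file can be read off.\<close>

lemma decoder_correct: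
  assumes s: "s < 2 ^ b"
    and good: "\<And>t. \<not> annihilated (col s) (slots (n - b) t) (phase_coords D p r t)"
    and fin: "\<And>t. finite (phase_coords D p r t)"
    and w: "\<And>l. l < D \<Longrightarrow> w l < M" and d: "fst d < D" "snd d < D" and j: "j < 2"
  shows "decoder d j (cache_index j (cache_content j (word False s (placement s w P))))
    (word True s (delivery s d w P)) = w (demand d j)"
proof -
  define X where "X = placement s w P"
  define Y where "Y = delivery s d w P"
  have X: "lin (col s) X \<inter> cached_coords D p = cached_bits w"
  proof -
    have sub: "cached_bits w \<subseteq> cached_coords D p"
      by (auto simp: cached_bits_def cached_coords_def)
    have pre: "lin (col s) (preimage s False (T \<inter> cached_coords D p)) \<inter> cached_coords D p
        = T \<inter> cached_coords D p" for T
      using lin_preimage[OF good fin, where t = False and T = "T \<inter> cached_coords D p"] by (simp add: phase_coords_def)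
    have lin: "lin (col s) X = sym_diff (lin (col s) (P \<inter> slots (n - b) False))
        (lin (col s) (preimage s False
          (sym_diff (cached_bits w) (lin (col s) (P \<inter> slots (n - b) False)) \<inter> cached_coords D p)))"
      unfolding X_def placement_def Let_def
      by (rule lin_sym_diff) (auto intro: finite_subset[OF preimage_subset])
    show ?thesis
      by (rule sym_diff_correction[where R = "{}", simplified, OF sub pre lin])
  qed
  have Y: "sym_diff (lin (col s) X) (lin (col s) Y) \<inter> delivery_coords p r = delivered_bits d w"
  proof -
    have sub: "delivered_bits d w \<subseteq> delivery_coords p r"
      by (auto simp: delivered_bits_def delivery_coords_def)
    have pre: "lin (col s) (preimage s True (T \<inter> delivery_coords p r)) \<inter> delivery_coords p r
        = T \<inter> delivery_coords p r" for T
      using lin_preimage[OF good fin, where t = True and T = "T \<inter> delivery_coords p r"] by (simp add: phase_coords_def)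
    have lin: "lin (col s) Y = sym_diff (lin (col s) (P \<inter> slots (n - b) True))
        (lin (col s) (preimage s True (sym_diff (delivered_bits d w)
          (sym_diff (lin (col s) X) (lin (col s) (P \<inter> slots (n - b) True))) \<inter> delivery_coords p r)))"
      unfolding Y_def delivery_def Let_def X_def
      by (rule lin_sym_diff) (auto intro: finite_subset[OF preimage_subset])
    show ?thesis
      by (rule sym_diff_correction[OF sub pre lin])
  qed
  \<comment> \<open>Outside the cached coordinates placement contributes only keys. On the
    \<open>Common\<close> coordinates and those of receiver \<open>j\<close>, \<open>C\<close>
    therefore agrees with the whole placement syndrome.\<close>
  have lin_X: "lin (col s) X \<subseteq> cached_coords D p \<union> key_coords q"
  proof (rule lin_subset)
    fix x assume "x \<in> X"
    then have "x \<in> slots (n - b) False"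
      using placement_subset X_def by auto
    then show "col s x \<subseteq> cached_coords D p \<union> key_coords q"
      using col[of x s] by (auto simp: slots_def column_coords_def)
  qed
  define C where "C = lin (col s) X \<inter> receiver_coords D p q j"
  have content: "cache_content j (word False s X) = C"
    using s placement_subset by (simp add: cache_content_def seed_of_word body_of_word C_def X_def)
  have inv: "inv_into (Pow (receiver_coords D p q j)) (cache_index j) (cache_index j C) = C"
    by (rule inv_into_f_f) (use inj_cache j in \<open>auto simp: C_def\<close>)
  define V where "V = sym_diff (lin (col s) Y) C"
  have cached: "Cached j l i \<in> C \<longleftrightarrow> j * p + i \<in> file_bits (w l)" if "l < D" "i < p" for l i
    using that j X by (auto simp: C_def receiver_coords_def cached_coords_def cached_bits_def)
  have common: "Common i \<in> V \<longleftrightarrow>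
      (p + i \<in> file_bits (w (fst d))) \<noteq> (i \<in> file_bits (w (snd d)))" if "i < p" for i
  proof -
    have "Common i \<in> V \<longleftrightarrow> Common i \<in> sym_diff (lin (col s) X) (lin (col s) Y) \<inter> delivery_coords p r"
      using that lin_X
      by (auto simp: V_def C_def receiver_coords_def delivery_coords_def cached_coords_def key_coords_def)
    then show ?thesis
      unfolding Y using that by (auto simp: delivered_bits_def)
  qed
  have priv: "Private j i \<in> V \<longleftrightarrow> 2 * p + i \<in> file_bits (w (demand d j))" if "i < r" for i
  proof -
    have "Private j i \<in> V \<longleftrightarrow> Private j i \<in> sym_diff (lin (col s) X) (lin (col s) Y) \<inter> delivery_coords p r"
      using that lin_X j
      by (auto simp: V_def C_def receiver_coords_def delivery_coords_def cached_coords_def key_coords_def)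
    then show ?thesis
      unfolding Y using that j by (auto simp: delivered_bits_def)
  qed
  have dj: "demand d j < D"
    using d by (simp add: demand_def)
  have "x \<in> recovered_bits d j C V \<longleftrightarrow> x \<in> file_bits (w (demand d j))" for x
  proof -
    \<comment> \<open>The three blocks of a file, and the positions beyond its length, which occur
      on neither side.\<close>
    consider "x < p" | i where "i < p" "x = p + i" | i where "i < r" "x = 2 * p + i" | "x \<ge> 2 * p + r"
    proof -
      have "x < p \<or> (x - p < p \<and> x = p + (x - p)) \<or> (x - 2 * p < r \<and> x = 2 * p + (x - 2 * p)) \<or> x \<ge> 2 * p + r"
        by linarith
      then show thesis
        using that by blast
    qed
    moreover have "j = 0 \<or> j = 1"
      using j by auto
    ultimately show ?thesis
      using file_bits[OF w[OF dj]] d dj cached common priv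
      by cases (auto simp: recovered_bits_def demand_def)
  qed
  then have "recovered_bits d j C V = file_bits (w (demand d j))"
    by auto
  moreover have "inv_into {..<M} file_bits (file_bits (w (demand d j))) = w (demand d j)"
    by (rule inv_into_f_f[OF inj_file]) (use w dj in auto)
  ultimately have "decoder d j (cache_index j C) (word True s Y) = w (demand d j)"
    using s delivery_subset inv
    by (simp add: decoder_def Let_def V_def seed_of_word body_of_word Y_def)
  then show ?thesis
    by (simp add: content[unfolded X_def] Y_def)
qed


section \<open>The uniform randomness and the probability of error\<close>

abbreviation rand_space :: "(nat \<times> (bool \<times> nat) set) set" where
  "rand_space \<equiv> {..<2 ^ b} \<times> Pow (UNIV \<times> {..<n - b})"

lemma finite_rand_space: "finite rand_space" "rand_space \<noteq> {}"
  by (auto simp: lessThan_empty_iff)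

lemma map_rand: "map_pmf rand (rnd code) = pmf_of_set rand_space"
  unfolding code_def
  by (simp, rule map_pmf_of_set_bij_betw[OF rand]) (auto simp: lessThan_empty_iff)

lemma prob_seed:
  "measure_pmf.prob (pmf_of_set rand_space) {x. A (fst x)} = real (card {s. s < 2 ^ b \<and> A s}) / 2 ^ b"
proof -
  have "rand_space \<inter> {x. A (fst x)} = {s. s < 2 ^ b \<and> A s} \<times> Pow (UNIV \<times> {..<n - b})"
    by auto
  then show ?thesis
    by (subst measure_pmf_of_set) (use finite_rand_space in \<open>simp_all add: card_cartesian_product card_Pow\<close>)
qed

text \<open>Decoding can fail only for a seed with which one of the two phases cannot be
  encoded.\<close>

lemma error_prob_le:
  assumes fin: "\<And>t. finite (phase_coords D p r t)" and d: "fst d < D" "snd d < D"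
  shows "error_prob D M code d \<le> real (card {s. s < 2 ^ b \<and>
    (\<exists>t. annihilated (col s) (slots (n - b) t) (phase_coords D p r t))}) / 2 ^ b"
proof -
  let ?bad = "{x :: nat \<times> (bool \<times> nat) set.
    \<exists>t. annihilated (col (fst x)) (slots (n - b) t) (phase_coords D p r t)}"
  have files: "w l < M" if "w \<in> set_pmf (files_pmf D M)" "l < D" for w l
    using that M_pos by (auto simp: files_pmf_def set_pmf_of_set finite_PiE PiE_eq_empty_iff lessThan_empty_iff)
  have seed: "fst (rand u) < 2 ^ b" if "u \<in> set_pmf (rnd code)" for u
  proof -
    have "rand u \<in> set_pmf (map_pmf rand (rnd code))"
      using that by simp
    then show ?thesis
      using finite_rand_space by (auto simp: map_rand)
  qed
  have correct: "dec code d j (cache code j (enc_c code w u)) (enc_d code d w u) = w (demand d j)"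
    if "w \<in> set_pmf (files_pmf D M)" "u \<in> set_pmf (rnd code)" "rand u \<notin> ?bad" "j < 2" for w u j
    using decoder_correct[where s = "fst (rand u)" and w = w and d = d and P = "snd (rand u)",
        OF seed[OF that(2)] _ fin files[OF that(1)] d that(4)] that(3,4)
    by (simp add: code_def)
  have "error_prob D M code d \<le> measure_pmf.prob (joint_pmf D M code) (snd -` (rand -` ?bad))"
    unfolding error_prob_def
  proof (intro measure_pmf.finite_measure_mono_AE)
    show "AE x in measure_pmf (joint_pmf D M code).
      x \<in> {(w, u). \<exists>j<2. dec code d j (cache code j (enc_c code w u)) (enc_d code d w u) \<noteq> w (demand d j)} \<longrightarrow>
      x \<in> snd -` (rand -` ?bad)"
      by (clarsimp simp: AE_measure_pmf_iff joint_pmf_def) (use correct in blast)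
  qed auto
  also have "\<dots> = measure_pmf.prob (map_pmf rand (map_pmf snd (joint_pmf D M code))) ?bad"
    by simp
  also have "map_pmf snd (joint_pmf D M code) = rnd code"
    by (simp add: joint_pmf_def map_snd_pair_pmf)
  also have "map_pmf rand (rnd code) = pmf_of_set rand_space"
    by (rule map_rand)
  finally show ?thesis
    using prob_seed[of "\<lambda>s. \<exists>t. annihilated (col s) (slots (n - b) t) (phase_coords D p r t)"] by simp
qed

section \<open>Secrecy: shifting the randomness by an untapped word\<close>

lemma tap_word_cong:
  assumes "\<And>i. i < n - b \<Longrightarrow> i \<in> S \<Longrightarrow> (t, i) \<in> X \<longleftrightarrow> (t, i) \<in> X'"
  shows "tap n S (word t s X) = tap n S (word t s X')"
  using assms by (auto simp: tap_def word_def)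

lemma lin_slots:
  assumes "A \<subseteq> UNIV \<times> {..<n - b}"
  shows "lin g A = sym_diff (lin g (A \<inter> slots (n - b) False)) (lin g (A \<inter> slots (n - b) True))"
proof -
  have "A = sym_diff (A \<inter> slots (n - b) False) (A \<inter> slots (n - b) True)"
    using assms by (auto simp: slots_def)
  then show ?thesis
    using lin_sym_diff[of "A \<inter> slots (n - b) False" "A \<inter> slots (n - b) True" g] by simp
qed

lemma lin_sym_diff_slots:
  "lin g (sym_diff P A \<inter> slots (n - b) t)
    = sym_diff (lin g (P \<inter> slots (n - b) t)) (lin g (A \<inter> slots (n - b) t))"
proof -
  have "sym_diff P A \<inter> slots (n - b) t = sym_diff (P \<inter> slots (n - b) t) (A \<inter> slots (n - b) t)"
    by auto
  then show ?thesis
    using lin_sym_diff[of "P \<inter> slots (n - b) t" "A \<inter> slots (n - b) t" g] by simp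
qed

text \<open>Changing the files by a word \<open>A\<close> of the right syndrome changes both codewords by \<open>A\<close>:
  the arguments of \<^const>\<open>preimage\<close> stay the same.\<close>

lemma placement_shift:
  assumes A: "lin (col s) (A \<inter> slots (n - b) False) \<inter> cached_coords D p
    = sym_diff (cached_bits w) (cached_bits w')"
  shows "placement s w' (sym_diff P A) = sym_diff (placement s w P) (A \<inter> slots (n - b) False)"
proof -
  have "cached_bits w \<subseteq> cached_coords D p" "cached_bits w' \<subseteq> cached_coords D p"
    by (auto simp: cached_bits_def cached_coords_def)
  note eq = sym_diff_shift[OF this A]
  show ?thesis
    unfolding placement_def Let_def lin_sym_diff_slots eq by (rule sym_diff_Int_right)
qed

text \<open>The placement word changes by the first part of \<open>A\<close> and the random delivery
  word by the second. The target sees both syndromes, hence that of all of \<open>A\<close>.\<close>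

lemma delivery_shift:
  assumes A: "A \<subseteq> UNIV \<times> {..<n - b}"
    and c: "lin (col s) (A \<inter> slots (n - b) False) \<inter> cached_coords D p
      = sym_diff (cached_bits w) (cached_bits w')"
    and d: "lin (col s) A \<inter> delivery_coords p r = sym_diff (delivered_bits d w) (delivered_bits d w')"
  shows "delivery s d w' (sym_diff P A) = sym_diff (delivery s d w P) (A \<inter> slots (n - b) True)"
proof -
  have "delivered_bits d w \<subseteq> delivery_coords p r" "delivered_bits d w' \<subseteq> delivery_coords p r"
    by (auto simp: delivered_bits_def delivery_coords_def)
  note eq = sym_diff_shift2[OF this d[unfolded lin_slots[OF A]]]
  have lin: "lin (col s) (placement s w' (sym_diff P A))
      = sym_diff (lin (col s) (placement s w P)) (lin (col s) (A \<inter> slots (n - b) False))"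
    unfolding placement_shift[OF c] by (rule lin_sym_diff) (auto simp: finite_placement)
  show ?thesis
    unfolding delivery_def Let_def lin_sym_diff_slots lin eq
    by (rule sym_diff_Int_right)
qed

text \<open>For a good seed some word supported on the untapped positions has the difference of the
  secret bits of \<open>w\<close> and \<open>w'\<close> as its syndrome. Adding it to the randomness
  turns \<open>w\<close> into \<open>w'\<close> without changing the observation. For a bad seed the
  whole entropy of the files is charged.\<close>

lemma leakage_le:
  fixes S1 S2 :: "nat set"
  defines "U \<equiv> {(False, i) | i. i < n - b \<and> i \<notin> S1} \<union> {(True, i) | i. i < n - b \<and> i \<notin> S2}"
  assumes fin: "\<And>t. finite (phase_coords D p r t)"
  shows "leakage D n M code d S1 S2 \<le>
    real (card {s. s < 2 ^ b \<and> annihilated (col s) U (cached_coords D p \<union> delivery_coords p r)}) / 2 ^ b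
      * (real D * log 2 (real M))"
proof -
  define W where "W = Pi\<^sub>E {..<D} (\<lambda>_. {..<M})"
  define J where "J = cached_coords D p \<union> delivery_coords p r"
  define Z where "Z w x = (tap n S1 (word False (fst x) (placement (fst x) w (snd x))),
    tap n S2 (word True (fst x) (delivery (fst x) d w (snd x))))" for w and x :: "nat \<times> (bool \<times> nat) set"
  define B where "B = {x :: nat \<times> (bool \<times> nat) set. annihilated (col (fst x)) U J}"
  have W: "finite W" "W \<noteq> {}" "card W = M ^ D"
    using M_pos by (auto simp: W_def finite_PiE PiE_eq_empty_iff card_PiE lessThan_empty_iff)
  have fin_J: "finite J"
    using fin[of False] fin[of True] by (simp add: J_def phase_coords_def)
  have U: "U \<subseteq> UNIV \<times> {..<n - b}"
    by (auto simp: U_def)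
  have "leakage D n M code d S1 S2
      = mutual_info (map_pmf (\<lambda>(w, x). (w, Z w x)) (pair_pmf (pmf_of_set W) (map_pmf rand (rnd code))))"
    unfolding leakage_def joint_pmf_def files_pmf_def W_def pair_map_pmf2 pmf.map_comp
    by (rule arg_cong[where f = mutual_info], rule map_pmf_cong[OF refl]) (auto simp: Z_def code_def)
  also have "\<dots> = mutual_info (map_pmf (\<lambda>(w, x). (w, Z w x)) (pair_pmf (pmf_of_set W) (pmf_of_set rand_space)))"
    by (simp add: map_rand)
  also have "\<dots> \<le> measure_pmf.prob (pmf_of_set rand_space) B * log 2 (real (card W))"
  proof (rule mutual_info_le)
    fix w w' z
    have shift: "\<exists>A\<subseteq>U. \<forall>P. Z w' (s, sym_diff P A) = Z w (s, P)" if s: "\<not> annihilated (col s) U J" for s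
    proof -
      define T where "T = sym_diff (cached_bits w \<union> delivered_bits d w) (cached_bits w' \<union> delivered_bits d w')"
      have cd: "cached_bits v \<subseteq> cached_coords D p" "delivered_bits d v \<subseteq> delivery_coords p r" for v
        by (auto simp: cached_bits_def cached_coords_def delivered_bits_def delivery_coords_def)
      then have "T \<subseteq> J"
        unfolding T_def J_def by blast
      then obtain A where A: "A \<subseteq> U" "lin (col s) A \<inter> J = T"
        using lin_surj[OF finite_body[OF U] fin_J s] by blast
      have A': "A \<subseteq> UNIV \<times> {..<n - b}"
        using A U by auto
      have disj: "cached_coords D p \<inter> delivery_coords p r = {}"
        by (auto simp: cached_coords_def delivery_coords_def)
      note parts = sym_diff_components[OF A(2)[unfolded J_def T_def] cd(1) cd(1) cd(2) cd(2) disj]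
      have "lin (col s) (A \<inter> slots (n - b) True) \<subseteq> delivery_coords p r"
      proof (rule lin_subset)
        fix x assume "x \<in> A \<inter> slots (n - b) True"
        then show "col s x \<subseteq> delivery_coords p r"
          using col[of x s] by (auto simp: slots_def column_coords_def)
      qed
      \<comment> \<open>Delivery columns contain no cached coordinates, so the placement part of
        \<open>A\<close> alone accounts for the change of the cached bits.\<close>
      then have "lin (col s) (A \<inter> slots (n - b) False) \<inter> cached_coords D p
          = lin (col s) A \<inter> cached_coords D p"
        using disj unfolding lin_slots[OF A'] by blast
      then have c: "lin (col s) (A \<inter> slots (n - b) False) \<inter> cached_coords D p
          = sym_diff (cached_bits w) (cached_bits w')"
        using parts(1) by simp
      have "Z w' (s, sym_diff P A) = Z w (s, P)" for P
        unfolding Z_def fst_conv snd_conv placement_shift[OF c] delivery_shift[OF A' c parts(2)]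
        using A(1) by (intro conjI prod_eqI) (auto simp: U_def intro!: tap_word_cong)
      then show ?thesis
        using A(1) by blast
    qed
    \<comment> \<open>The shift depends on the seed only, and the seed is kept; hence
      \<open>F\<close> below is an involution that matches the outcomes for \<open>w\<close> with
      those for \<open>w'\<close>.\<close>
    define A where "A s = (SOME A. A \<subseteq> U \<and> (\<forall>P. Z w' (s, sym_diff P A) = Z w (s, P)))" for s
    have A: "A s \<subseteq> U" "Z w' (s, sym_diff P (A s)) = Z w (s, P)" if "\<not> annihilated (col s) U J" for s P
      using someI_ex[OF shift[OF that]] unfolding A_def by blast+
    define F where "F x = (fst x, sym_diff (snd x) (A (fst x)))" for x
    have "Z w' x = Z w (F x)" if "\<not> annihilated (col (fst x)) U J" for x
    proof -
      have "sym_diff (sym_diff (snd x) (A (fst x))) (A (fst x)) = snd x"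
        by auto
      then show ?thesis
        using A(2)[OF that, of "sym_diff (snd x) (A (fst x))"] by (simp add: F_def)
    qed
    moreover have "Z w' (F x) = Z w x" if "\<not> annihilated (col (fst x)) U J" for x
      using A(2)[OF that, of "snd x"] by (simp add: F_def)
    moreover have "F x \<in> rand_space" if "x \<in> rand_space" "\<not> annihilated (col (fst x)) U J" for x
      using that A(1)[OF that(2)] U unfolding F_def by fastforce
    moreover have "F (F x) = x" "fst (F x) = fst x" for x
      by (auto simp: F_def prod_eq_iff)
    ultimately have "bij_betw F (rand_space \<inter> {x. x \<notin> B \<and> Z w x = z}) (rand_space \<inter> {x. x \<notin> B \<and> Z w' x = z})"
      by (intro bij_betwI[where g = F]) (auto simp: B_def)
    then show "measure_pmf.prob (pmf_of_set rand_space) {x. x \<notin> B \<and> Z w x = z}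
        = measure_pmf.prob (pmf_of_set rand_space) {x. x \<notin> B \<and> Z w' x = z}"
      using finite_rand_space by (simp add: measure_pmf_of_set bij_betw_same_card)
  qed (use W finite_rand_space in auto)
  also have "log 2 (real (card W)) = real D * log 2 (real M)"
    using M_pos by (simp add: W log_nat_power)
  finally show ?thesis
    using prob_seed[of "\<lambda>s. annihilated (col s) U J"] by (simp add: B_def J_def)
qed

end

section \<open>Choice of the matrices\<close>

text \<open>There are fewer than \<open>2 ^ card K\<close> terms. An empty \<open>K\<close> has none
  at all and puts no condition on \<open>e\<close>.\<close>

lemma sum_Pow_half_le:
  assumes "finite K" "K = {} \<or> card K + s \<le> e"
  shows "(\<Sum>B\<in>Pow K - {{}}. (1/2 :: real) ^ e) \<le> (1/2) ^ s"
proof (cases "K = {}")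
  case False
  then have e: "card K + s \<le> e"
    using assms by auto
  have "(\<Sum>B\<in>Pow K - {{}}. (1/2 :: real) ^ e) \<le> (\<Sum>B\<in>Pow K. (1/2) ^ e)"
    using assms by (intro sum_mono2) auto
  also have "\<dots> = 2 ^ card K * (1/2) ^ e"
    using assms by (simp add: card_Pow)
  also have "\<dots> \<le> 2 ^ card K * (1/2) ^ (card K + s)"
    using e by (intro mult_left_mono power_decreasing) auto
  also have "\<dots> = (1/2) ^ s"
    by (simp add: power_add power_one_over)
  finally show ?thesis .
qed simp

section \<open>Sizes of the coordinate sets\<close>

lemma cached_coords_image:
  "cached_coords D p = (\<lambda>(j, l, i). Cached j l i) ` ({..<2} \<times> {..<D} \<times> {..<p})"
  by (auto simp: cached_coords_def image_iff)

lemma finite_cached_coords [simp]: "finite (cached_coords D p)"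
  by (simp add: cached_coords_image)

lemma card_cached_coords: "card (cached_coords D p) = 2 * D * p"
  unfolding cached_coords_image
  by (subst card_image) (auto simp: inj_on_def card_cartesian_product)

text \<open>The lower limit \<open>q\<close> serves two cases: 0 gives all delivery coordinates, the
  number of keys gives the unmasked ones.\<close>

lemma card_delivery_coords_aux:
  "finite ({Common i | i. i < p} \<union> {Private j i | j i. j < (2::nat) \<and> q \<le> i \<and> i < r})"
  "card ({Common i | i. i < p} \<union> {Private j i | j i. j < (2::nat) \<and> q \<le> i \<and> i < r}) = p + 2 * (r - q)"
proof -
  have 1: "{Common i | i. i < p} = Common ` {..<p}"
    by auto
  have 2: "{Private j i | j i. j < (2::nat) \<and> q \<le> i \<and> i < r} = (\<lambda>(j, i). Private j i) ` ({..<2} \<times> {q..<r})"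
    by (auto simp: image_iff)
  show "finite ({Common i | i. i < p} \<union> {Private j i | j i. j < (2::nat) \<and> q \<le> i \<and> i < r})"
    unfolding 1 2 by simp
  have "card (Common ` {..<p}) = p"
    by (subst card_image) (auto simp: inj_on_def)
  moreover have "card ((\<lambda>(j, i). Private j i) ` ({..<2} \<times> {q..<r})) = 2 * (r - q)"
    by (subst card_image) (auto simp: inj_on_def card_cartesian_product)
  ultimately show "card ({Common i | i. i < p} \<union> {Private j i | j i. j < (2::nat) \<and> q \<le> i \<and> i < r}) = p + 2 * (r - q)"
    unfolding 1 2 by (subst card_Un_disjoint) auto
qed

lemma finite_delivery_coords [simp]: "finite (delivery_coords p r)"
  and card_delivery_coords: "card (delivery_coords p r) = p + 2 * r"
  using card_delivery_coords_aux[of p 0 r] by (simp_all add: delivery_coords_def)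

lemma card_unkeyed_coords: "card (delivery_coords p r - key_coords q) = p + 2 * (r - q)"
proof -
  have "delivery_coords p r - key_coords q
      = {Common i | i. i < p} \<union> {Private j i | j i. j < 2 \<and> q \<le> i \<and> i < r}"
    by (auto simp: delivery_coords_def key_coords_def)
  then show ?thesis
    by (simp add: card_delivery_coords_aux)
qed

lemma finite_key_coords [simp]: "finite (key_coords q)"
  by (rule finite_subset[OF _ finite_delivery_coords[of 0 q]])
    (auto simp: delivery_coords_def key_coords_def)

lemma finite_column_coords: "finite (column_coords D p q r x)"
  by (simp add: column_coords_def)

lemma finite_phase_coords: "finite (phase_coords D p r t)"
  by (simp add: phase_coords_def)

lemma receiver_coords_image:
  "receiver_coords D p q j = (\<lambda>(l, i). Cached j l i) ` ({..<D} \<times> {..<p}) \<union> Private j ` {..<q}"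
  by (auto simp: receiver_coords_def image_iff)

lemma finite_receiver_coords: "finite (receiver_coords D p q j)"
  by (simp add: receiver_coords_image)

lemma card_receiver_coords: "card (receiver_coords D p q j) = D * p + q"
proof -
  have "card ((\<lambda>(l, i). Cached j l i) ` ({..<D} \<times> {..<p})) = D * p"
    by (subst card_image) (auto simp: inj_on_def card_cartesian_product)
  moreover have "card (Private j ` {..<q}) = q"
    by (subst card_image) (auto simp: inj_on_def)
  ultimately show ?thesis
    unfolding receiver_coords_image by (subst card_Un_disjoint) auto
qed

text \<open>A nonempty set \<open>B\<close> of coordinates meets the columns of both phases, or only those of the
  delivery phase, or only those of the placement phase.\<close>

lemma annihilator_sum_le:
  assumes "q \<le> r" and U: "U = {(False, i) | i. i \<in> P} \<union> {(True, i) | i. i \<in> Q}" "finite P" "finite Q"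
    and all: "p = 0 \<and> r = 0 \<or> 2 * D * p + (p + 2 * r) + (b + 2) \<le> card P + card Q"
    and placed: "D * p = 0 \<or> 2 * D * p + (b + 2) \<le> card P"
    and unkeyed: "p = 0 \<and> q = r \<or> p + 2 * (r - q) + (b + 2) \<le> card Q"
  shows "(\<Sum>B\<in>Pow (cached_coords D p \<union> delivery_coords p r) - {{}}.
    (1/2) ^ card {x \<in> U. B \<inter> column_coords D p q r x \<noteq> {}}) \<le> (1/2 :: real) ^ b"
proof -
  define C where "C = cached_coords D p"
  define E where "E = delivery_coords p r"
  define K where "K = key_coords q"
  have fin: "finite C" "finite E" "finite K"
    by (simp_all add: C_def E_def K_def)
  have KE: "K \<subseteq> E" and CE: "C \<inter> E = {}"
    using \<open>q \<le> r\<close> by (auto simp: C_def E_def K_def cached_coords_def key_coords_def delivery_coords_def)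
  define f where "f B = (1/2 :: real) ^ card {x \<in> U. B \<inter> column_coords D p q r x \<noteq> {}}" for B
  have fin_U: "finite U"
    using U by (simp add: setcompr_eq_image)
  have cP: "card {(False, i) | i. i \<in> P} = card P" and cQ: "card {(True, i) | i. i \<in> Q} = card Q"
    unfolding setcompr_eq_image by (auto intro!: card_image simp: inj_on_def)
  have f_bound: "f B \<le> (1/2) ^ (card P + card Q) + (if B \<subseteq> E - K then (1/2) ^ card Q else 0)
      + (if B \<subseteq> C then (1/2) ^ card P else 0)" if B: "B \<in> Pow (C \<union> E) - {{}}" for B
  proof -
    have le: "f B \<le> (1/2) ^ card V" if "V \<subseteq> {x \<in> U. B \<inter> column_coords D p q r x \<noteq> {}}" for V
      unfolding f_def using fin_U card_mono[OF _ that] by (intro power_decreasing) auto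
    have nonneg: "0 \<le> (if b then (1/2) ^ k else 0 :: real)" for b k
      by simp
    \<comment> \<open>A set inside \<open>C\<close> is seen by all untapped placement positions, one
      inside \<open>E - K\<close> by all untapped delivery positions, and any other nonempty set by
      both, because key coordinates belong to both phases.\<close>
    consider "B \<subseteq> C" | "B \<subseteq> E - K" | "B \<inter> (C \<union> K) \<noteq> {}" "B \<inter> E \<noteq> {}"
      using B by blast
    then show ?thesis
    proof cases
      case 1
      then have "B \<inter> (C \<union> K) \<noteq> {}"
        using B by blast
      then have "{(False, i) | i. i \<in> P} \<subseteq> {x \<in> U. B \<inter> column_coords D p q r x \<noteq> {}}"
        by (auto simp: U column_coords_def C_def K_def)
      from le[OF this] have "f B \<le> (1/2) ^ card P"
        unfolding cP .
      then show ?thesis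
        using nonneg[of True "card P + card Q"] nonneg[of "B \<subseteq> E - K" "card Q"]
        unfolding if_P[OF 1] if_True by linarith
    next
      case 2
      then have "B \<inter> E \<noteq> {}"
        using B by blast
      then have "{(True, i) | i. i \<in> Q} \<subseteq> {x \<in> U. B \<inter> column_coords D p q r x \<noteq> {}}"
        by (auto simp: U column_coords_def E_def)
      from le[OF this] have "f B \<le> (1/2) ^ card Q"
        unfolding cQ .
      then show ?thesis
        using nonneg[of True "card P + card Q"] nonneg[of "B \<subseteq> C" "card P"]
        unfolding if_P[OF 2] if_True by linarith
    next
      case 3
      then have "U \<subseteq> {x \<in> U. B \<inter> column_coords D p q r x \<noteq> {}}"
        by (auto simp: column_coords_def C_def E_def K_def U)
      from le[OF this] have "f B \<le> (1/2) ^ card U" .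
      also have "card U = card {(False, i) | i. i \<in> P} + card {(True, i) | i. i \<in> Q}"
        unfolding U(1) by (rule card_Un_disjoint) (use U(2,3) in \<open>auto simp: setcompr_eq_image\<close>)
      also have "\<dots> = card P + card Q"
        unfolding cP cQ ..
      finally show ?thesis
        by (auto intro!: add_increasing2)
    qed
  qed
  have "(\<Sum>B\<in>Pow (C \<union> E) - {{}}. f B)
      \<le> (\<Sum>B\<in>Pow (C \<union> E) - {{}}. (1/2) ^ (card P + card Q)
          + (if B \<subseteq> E - K then (1/2) ^ card Q else 0) + (if B \<subseteq> C then (1/2) ^ card P else 0))"
    by (intro sum_mono f_bound)
  also have "\<dots> = (\<Sum>B\<in>Pow (C \<union> E) - {{}}. (1/2) ^ (card P + card Q))
      + (\<Sum>B\<in>Pow (C \<union> E) - {{}}. if B \<subseteq> E - K then (1/2) ^ card Q else 0)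
      + (\<Sum>B\<in>Pow (C \<union> E) - {{}}. if B \<subseteq> C then (1/2) ^ card P else 0)"
    by (simp add: sum.distrib)
  also have "(\<Sum>B\<in>Pow (C \<union> E) - {{}}. if B \<subseteq> E - K then (1/2) ^ card Q else 0)
      = (\<Sum>B\<in>Pow (E - K) - {{}}. (1/2 :: real) ^ card Q)"
    using fin by (intro sum.mono_neutral_cong_right) auto
  also have "(\<Sum>B\<in>Pow (C \<union> E) - {{}}. if B \<subseteq> C then (1/2) ^ card P else 0)
      = (\<Sum>B\<in>Pow C - {{}}. (1/2 :: real) ^ card P)"
    using fin by (intro sum.mono_neutral_cong_right) auto
  also have "(\<Sum>B\<in>Pow (C \<union> E) - {{}}. (1/2 :: real) ^ (card P + card Q)) \<le> (1/2) ^ (b + 2)"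
  proof (rule sum_Pow_half_le)
    have "card (C \<union> E) = 2 * D * p + (p + 2 * r)"
      using fin CE by (subst card_Un_disjoint) (auto simp: C_def E_def card_cached_coords card_delivery_coords)
    then show "C \<union> E = {} \<or> card (C \<union> E) + (b + 2) \<le> card P + card Q"
      using all by (auto simp: C_def E_def cached_coords_def delivery_coords_def)
  qed (use fin in auto)
  also have "(\<Sum>B\<in>Pow (E - K) - {{}}. (1/2 :: real) ^ card Q) \<le> (1/2) ^ (b + 2)"
  proof (rule sum_Pow_half_le)
    have "E - K = {}" if "p = 0" "q = r"
      using that by (auto simp: E_def K_def delivery_coords_def key_coords_def)
    then show "E - K = {} \<or> card (E - K) + (b + 2) \<le> card Q"
      using unkeyed by (auto simp: E_def K_def card_unkeyed_coords)
  qed (use fin in auto)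
  also have "(\<Sum>B\<in>Pow C - {{}}. (1/2 :: real) ^ card P) \<le> (1/2) ^ (b + 2)"
  proof (rule sum_Pow_half_le)
    show "C = {} \<or> card C + (b + 2) \<le> card P"
      using placed by (auto simp: C_def card_cached_coords) (auto simp: cached_coords_def)
  qed (use fin in auto)
  \<comment> \<open>The slack \<open>b + 2\<close> in the hypotheses leaves room for three such
    terms below \<open>(1/2) ^ b\<close>.\<close>
  finally have "(\<Sum>B\<in>Pow (C \<union> E) - {{}}. f B) \<le> (1/2) ^ (b + 2) + (1/2) ^ (b + 2) + (1/2) ^ (b + 2)"
    by simp
  also have "\<dots> \<le> (1/2) ^ b"
    by (simp add: power_add)
  finally show ?thesis
    by (simp add: f_def C_def E_def)
qed

text \<open>This concerns encoding, without taps: every nonempty \<open>B\<close> of the phase meets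
  the range of each of its \<open>m\<close> columns.\<close>

lemma annihilator_sum_phase_le:
  assumes "phase_coords D p r t = {} \<or> card (phase_coords D p r t) + b \<le> m"
  shows "(\<Sum>B\<in>Pow (phase_coords D p r t) - {{}}.
    (1/2) ^ card {x \<in> slots m t. B \<inter> column_coords D p q r x \<noteq> {}}) \<le> (1/2 :: real) ^ b"
proof -
  have "{x \<in> slots m t. B \<inter> column_coords D p q r x \<noteq> {}} = slots m t"
    if "B \<in> Pow (phase_coords D p r t) - {{}}" for B
    using that by (auto simp: slots_def column_coords_def phase_coords_def split: if_splits)
  moreover have "card (slots m t) = m"
    by (simp add: slots_def card_cartesian_product)
  ultimately show ?thesis
    using sum_Pow_half_le[OF finite_phase_coords assms] by simp
qed


section \<open>Assembling the scheme\<close>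

lemma exists_injection_Pow:
  assumes "finite A" "N \<le> 2 ^ card A"
  shows "\<exists>f :: nat \<Rightarrow> 'a set. inj_on f {..<N} \<and> (\<forall>x<N. f x \<subseteq> A)"
proof -
  have "card {..<N} \<le> card (Pow A)"
    using assms by (simp add: card_Pow)
  then have "\<exists>f. inj_on f {..<N} \<and> f ` {..<N} \<subseteq> Pow A"
    using inj_on_iff_card_le[of "{..<N}" "Pow A"] assms by auto
  then show ?thesis
    by blast
qed

text \<open>One family of columns must serve secrecy (rows \<open>J\<close>) and the encoding of
  either phase (rows \<open>phase_coords\<close>), so the derandomisation runs over all three row
  sets together. The alternatives with \<open>p = 0\<close> are the cases where the relevant
  coordinate set is empty.\<close>

lemma scheme_exists:
  fixes \<alpha> :: real
  assumes "b \<le> n" and qr: "q \<le> r" and cache_size: "D * p + q \<le> n div 2" and M: "0 < M" "M \<le> 2 ^ (2 * p + r)"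
    and m: "m = n - b" and "0 \<le> \<alpha>"
    and delivered: "p = 0 \<and> r = 0 \<or> p + 2 * r + b \<le> m"
    and all: "p = 0 \<and> r = 0 \<or> real (2 * D * p + (p + 2 * r) + (b + 2)) \<le> 2 * real m - \<alpha> * real n"
    and placed: "p = 0 \<or> real (2 * D * p + (b + 2)) \<le> real m - \<alpha> * real n"
    and unkeyed: "p = 0 \<and> q = r \<or> real (p + 2 * (r - q) + (b + 2)) \<le> real m - \<alpha> * real n"
  shows "\<exists>c. valid_code n c \<and>
    (\<forall>d\<in>{..<D} \<times> {..<D}. error_prob D M c d \<le> 2 * (2 * real n + 4) / 2 ^ b) \<and>
    (\<forall>d. \<forall>(S1, S2)\<in>tap_sets \<alpha> n. leakage D n M c d S1 S2 \<le> (2 * real n + 4) / 2 ^ b * (real D * log 2 (real M)))"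
proof -
  obtain file_bits :: "nat \<Rightarrow> nat set" where file_bits: "inj_on file_bits {..<M}"
    "\<forall>x<M. file_bits x \<subseteq> {..<2 * p + r}"
    using exists_injection_Pow[of "{..<2 * p + r}" M] M by auto
  obtain seed_bits :: "nat \<Rightarrow> nat set" where seed_bits: "inj_on seed_bits {..<2 ^ b}"
    "\<forall>x<2 ^ b. seed_bits x \<subseteq> {n - b..<n}"
    using exists_injection_Pow[of "{n - b..<n}" "2 ^ b"] \<open>b \<le> n\<close> by auto
  have "\<exists>f. inj_on f (Pow (receiver_coords D p q j)) \<and>
      f ` Pow (receiver_coords D p q j) \<subseteq> {..<2 ^ (n div 2) :: nat}" for j
  proof -
    have "card (Pow (receiver_coords D p q j)) \<le> 2 ^ (n div 2)"
      using cache_size by (simp add: card_Pow finite_receiver_coords card_receiver_coords)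
    then show ?thesis
      using inj_on_iff_card_le[of "Pow (receiver_coords D p q j)" "{..<2 ^ (n div 2) :: nat}"]
      by (simp add: finite_receiver_coords)
  qed
  then obtain cache_index :: "nat \<Rightarrow> coord set \<Rightarrow> nat" where cache_index:
    "\<And>j. inj_on (cache_index j) (Pow (receiver_coords D p q j)) \<and>
      cache_index j ` Pow (receiver_coords D p q j) \<subseteq> {..<2 ^ (n div 2)}"
    by metis
  define I :: "(bool \<times> nat) set" where "I = UNIV \<times> {..<n - b}"
  have card_I: "card I = 2 * (n - b)" and fin_I: "finite I"
    by (simp_all add: I_def card_cartesian_product)
  obtain rand :: "nat \<Rightarrow> nat \<times> (bool \<times> nat) set" where
    rand: "bij_betw rand {..<2 ^ b * 2 ^ (2 * (n - b))} ({..<2 ^ b} \<times> Pow I)"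
    using finite_same_card_bij[of "{..<2 ^ b * 2 ^ (2 * (n - b)) :: nat}" "{..<2 ^ b :: nat} \<times> Pow I"] fin_I
    by (auto simp: card_cartesian_product card_Pow card_I)
  define J where "J = cached_coords D p \<union> delivery_coords p r"
  define \<J> where "\<J> = {J, phase_coords D p r False, phase_coords D p r True}"
  have card_\<J>: "card \<J> \<le> 3"
    using card_insert_le_m1[of 3 "{phase_coords D p r False, phase_coords D p r True}" J]
      card_insert_le_m1[of 2 "{phase_coords D p r True}" "phase_coords D p r False"]
    by (simp add: \<J>_def)
  have fin_\<J>: "finite \<J>" "\<forall>J'\<in>\<J>. finite J'"
    by (auto simp: \<J>_def J_def finite_phase_coords)
  obtain col :: "nat \<Rightarrow> bool \<times> nat \<Rightarrow> coord set" where col: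
    "\<forall>s. \<forall>x\<in>I. col s x \<subseteq> column_coords D p q r x"
    and few: "\<forall>U J. U \<subseteq> I \<longrightarrow> J \<in> \<J> \<longrightarrow>
      (\<Sum>B\<in>Pow J - {{}}. (1/2) ^ card {i \<in> U. B \<inter> column_coords D p q r i \<noteq> {}}) \<le> (1/2 :: real) ^ b \<longrightarrow>
      2 ^ card {s :: nat. s < 2 ^ b \<and> annihilated (col s) U J} \<le> 4 * 2 ^ card I * card \<J>"
    using exists_columns_few_bad[where G = "column_coords D p q r" and b = b, OF fin_I finite_column_coords fin_\<J>]
    by (elim exE conjE) (rule that)
  have few': "real (card {s. s < 2 ^ b \<and> annihilated (col s) U J'}) \<le> 2 * real n + 4"
    if "U \<subseteq> I" "J' \<in> \<J>"
      "(\<Sum>B\<in>Pow J' - {{}}. (1/2) ^ card {i \<in> U. B \<inter> column_coords D p q r i \<noteq> {}}) \<le> (1/2 :: real) ^ b" for U J'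
  proof -
    have "2 ^ card {s. s < 2 ^ b \<and> annihilated (col s) U J'} \<le> 4 * 2 ^ card I * card \<J>"
      using few that by simp
    also have "\<dots> \<le> 4 * 2 ^ (2 * n) * 4"
      using card_\<J> by (intro mult_mono power_increasing) (auto simp: card_I)
    also have "\<dots> = (2 :: nat) ^ (2 * n + 4)"
      by (simp add: power_add)
    finally have "card {s. s < 2 ^ b \<and> annihilated (col s) U J'} \<le> 2 * n + 4"
      by (rule power_le_imp_le_exp[rotated]) simp
    then show ?thesis
      by linarith
  qed
  interpret caching_scheme D n b p q r M col file_bits seed_bits cache_index rand
  proof
    show "cache_index j T < 2 ^ (n div 2)" if "T \<subseteq> receiver_coords D p q j" for j T
      using cache_index[of j] that by blast
    show "col s x \<subseteq> column_coords D p q r x" if "snd x < n - b" for s x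
    proof -
      have "x \<in> I"
        using that by (simp add: I_def mem_Times_iff)
      then show ?thesis
        using col by blast
    qed
  qed (use \<open>b \<le> n\<close> qr M(1) file_bits seed_bits cache_index rand in \<open>auto simp: I_def\<close>)
  have "error_prob D M code d \<le> 2 * (2 * real n + 4) / 2 ^ b" if "d \<in> {..<D} \<times> {..<D}" for d
  proof -
    define A where "A t = {s. s < 2 ^ b \<and> annihilated (col s) (slots (n - b) t) (phase_coords D p r t)}" for t
    have A: "real (card (A t)) \<le> 2 * real n + 4" for t
      unfolding A_def
    proof (rule few'[OF _ _ annihilator_sum_phase_le])
      show "slots (n - b) t \<subseteq> I"
        by (auto simp: slots_def I_def)
      show "phase_coords D p r t \<in> \<J>"
        by (cases t) (auto simp: \<J>_def)
      show "phase_coords D p r t = {} \<or> card (phase_coords D p r t) + b \<le> n - b"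
      proof (cases t)
        case True
        then show ?thesis
          using delivered m by (auto simp: phase_coords_def card_delivery_coords) (auto simp: delivery_coords_def)
      next
        case False
        have "0 \<le> \<alpha> * real n"
          using \<open>0 \<le> \<alpha>\<close> by simp
        then have "p = 0 \<or> real (2 * D * p + (b + 2)) \<le> real m"
          using placed by linarith
        then have "p = 0 \<or> 2 * D * p + (b + 2) \<le> m"
          unfolding of_nat_le_iff .
        then show ?thesis
          using False m by (auto simp: phase_coords_def card_cached_coords) (auto simp: cached_coords_def)
      qed
    qed
    have "{s. s < 2 ^ b \<and> (\<exists>t. annihilated (col s) (slots (n - b) t) (phase_coords D p r t))} = A False \<union> A True"
      by (auto simp: A_def) (metis (full_types))
    then have "real (card {s. s < 2 ^ b \<and> (\<exists>t. annihilated (col s) (slots (n - b) t) (phase_coords D p r t))})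
        \<le> real (card (A False)) + real (card (A True))"
      by (simp only: of_nat_add[symmetric] of_nat_le_iff card_Un_le)
    also have "\<dots> \<le> 2 * (2 * real n + 4)"
      using add_mono[OF A[of False] A[of True]] by simp
    finally have "real (card {s. s < 2 ^ b \<and> (\<exists>t. annihilated (col s) (slots (n - b) t) (phase_coords D p r t))}) / 2 ^ b
        \<le> 2 * (2 * real n + 4) / 2 ^ b"
      by (intro divide_right_mono) auto
    then show ?thesis
      using error_prob_le[of d] that finite_phase_coords by auto
  qed
  moreover have "leakage D n M code d S1 S2 \<le> (2 * real n + 4) / 2 ^ b * (real D * log 2 (real M))"
    if "(S1, S2) \<in> tap_sets \<alpha> n" for d S1 S2
  proof -
    define P where "P = {..<m} - S1"
    define Q where "Q = {..<m} - S2"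
    define U where "U = {(False, i) | i. i < n - b \<and> i \<notin> S1} \<union> {(True, i) | i. i < n - b \<and> i \<notin> S2}"
    have U: "U = {(False, i) | i. i \<in> P} \<union> {(True, i) | i. i \<in> Q}"
      by (auto simp: U_def P_def Q_def m)
    have taps: "S1 \<subseteq> {..<n}" "S2 \<subseteq> {..<n}" "real (card S1) + real (card S2) \<le> \<alpha> * real n"
      using that by (auto simp: tap_sets_def)
    have fin: "finite P" "finite Q" "finite S1" "finite S2"
      using taps(1,2) by (auto simp: P_def Q_def finite_subset)
    have "m \<le> card P + card S1" "m \<le> card Q + card S2"
      using diff_card_le_card_Diff[OF fin(3), of "{..<m}"] diff_card_le_card_Diff[OF fin(4), of "{..<m}"]
      by (auto simp: P_def Q_def)
    \<comment> \<open>The first two bounds allow for all taps falling into one phase. The third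
      holds however they are divided.\<close>
    then have PQ: "real m - \<alpha> * real n \<le> real (card P)" "real m - \<alpha> * real n \<le> real (card Q)"
        "2 * real m - \<alpha> * real n \<le> real (card P + card Q)"
      using taps(3) by linarith+
    have "real (card {s. s < 2 ^ b \<and> annihilated (col s) U J}) \<le> 2 * real n + 4"
    proof (rule few')
      show "U \<subseteq> I"
        by (auto simp: U_def I_def)
      show "J \<in> \<J>"
        by (simp add: \<J>_def)
      show "(\<Sum>B\<in>Pow J - {{}}. (1/2) ^ card {i \<in> U. B \<inter> column_coords D p q r i \<noteq> {}}) \<le> (1/2 :: real) ^ b"
        unfolding J_def
      proof (rule annihilator_sum_le[OF qr U fin(1,2)])
        show "p = 0 \<and> r = 0 \<or> 2 * D * p + (p + 2 * r) + (b + 2) \<le> card P + card Q"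
          using all PQ(3) unfolding of_nat_le_iff[symmetric, where 'a = real] by linarith
        show "D * p = 0 \<or> 2 * D * p + (b + 2) \<le> card P"
          using placed PQ(1) unfolding of_nat_le_iff[symmetric, where 'a = real] by auto
        show "p = 0 \<and> q = r \<or> p + 2 * (r - q) + (b + 2) \<le> card Q"
          using unkeyed PQ(2) unfolding of_nat_le_iff[symmetric, where 'a = real] by linarith
      qed
    qed
    then have "real (card {s. s < 2 ^ b \<and> annihilated (col s) U J}) / 2 ^ b * (real D * log 2 (real M))
        \<le> (2 * real n + 4) / 2 ^ b * (real D * log 2 (real M))"
      using M by (intro mult_right_mono divide_right_mono) auto
    then show ?thesis
      using leakage_le[OF finite_phase_coords, of d S1 S2]
      unfolding U_def[symmetric] J_def[symmetric] by linarith
  qed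
  ultimately show ?thesis
    using valid_code by blast
qed

section \<open>Asymptotics\<close>

lemma num_msgs_pos: "num_msgs n R > 0"
  by (simp add: num_msgs_def)

lemma num_msgs_le:
  assumes "real n * R \<le> real k"
  shows "num_msgs n R \<le> 2 ^ k"
proof -
  have "2 powr (real n * R) \<le> 2 powr real k"
    using assms by (intro powr_mono) auto
  then have "\<lceil>2 powr (real n * R)\<rceil> \<le> 2 ^ k"
    by (simp add: ceiling_le_iff powr_realpow)
  then show ?thesis
    by (simp add: num_msgs_def nat_le_iff)
qed

text \<open>Rounding up at most doubles a number that is at least 1; the absolute value ensures this
  for negative rates too.\<close>

lemma log_num_msgs_le: "log 2 (real (num_msgs n R)) \<le> real n * \<bar>R\<bar> + 1"
proof -
  have "real (num_msgs n R) \<le> 2 powr (real n * R) + 1"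
    unfolding num_msgs_def by (simp add: of_nat_nat ceiling_correct)
  also have "\<dots> \<le> 2 powr (real n * \<bar>R\<bar>) + 2 powr (real n * \<bar>R\<bar>)"
  proof (rule add_mono)
    show "2 powr (real n * R) \<le> 2 powr (real n * \<bar>R\<bar>)"
      by (intro powr_mono mult_left_mono) auto
    show "1 \<le> 2 powr (real n * \<bar>R\<bar>)"
      by (rule ge_one_powr_ge_zero) auto
  qed
  also have "\<dots> = 2 powr (real n * \<bar>R\<bar> + 1)"
    by (simp add: powr_add)
  finally have "log 2 (real (num_msgs n R)) \<le> log 2 (2 powr (real n * \<bar>R\<bar> + 1))"
    using num_msgs_pos[of n R] by (subst log_le_cancel_iff) auto
  then show ?thesis
    by simp
qed

text \<open>A default for the block lengths too small for the construction, since
  \<open>achievable\<close> asks for a valid code at every length.\<close>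

lemma exists_valid_code: "\<exists>c. valid_code n c"
proof
  show "valid_code n \<lparr>enc_c = \<lambda>w u. replicate n False, cache = \<lambda>j x. 0,
    enc_d = \<lambda>d w u. replicate n False, dec = \<lambda>d j k x. 0, rnd = return_pmf 0\<rparr>"
    by (simp add: valid_code_def ge_one_powr_ge_zero)
qed

lemma leakage_nonneg:
  assumes "valid_code n c"
  shows "0 \<le> leakage D n (num_msgs n R) c d S1 S2"
proof -
  have "finite (set_pmf (files_pmf D (num_msgs n R)))"
    using num_msgs_pos[of n R]
    by (simp add: files_pmf_def set_pmf_of_set finite_PiE PiE_eq_empty_iff lessThan_empty_iff)
  then have "finite (set_pmf (joint_pmf D (num_msgs n R) c))"
    using assms by (simp add: joint_pmf_def valid_code_def)
  then show ?thesis
    unfolding leakage_def by (intro mutual_info_nonneg) simp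
qed

lemma achievableI:
  fixes e l :: "nat \<Rightarrow> real"
  assumes "D > 0" "0 \<le> \<alpha>" "e \<longlonglongrightarrow> 0" "l \<longlonglongrightarrow> 0"
    and ev: "\<forall>\<^sub>F n in sequentially. \<exists>c. valid_code n c \<and>
      (\<forall>d\<in>{..<D} \<times> {..<D}. error_prob D (num_msgs n R) c d \<le> e n) \<and>
      (\<forall>d. \<forall>(S1, S2)\<in>tap_sets \<alpha> n. leakage D n (num_msgs n R) c d S1 S2 \<le> l n)"
  shows "achievable D \<alpha> R"
proof -
  define good where "good n c \<longleftrightarrow> valid_code n c \<and>
      (\<forall>d\<in>{..<D} \<times> {..<D}. error_prob D (num_msgs n R) c d \<le> e n) \<and>
      (\<forall>d. \<forall>(S1, S2)\<in>tap_sets \<alpha> n. leakage D n (num_msgs n R) c d S1 S2 \<le> l n)" for n c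
  define code where "code n = (SOME c. if Ex (good n) then good n c else valid_code n c)" for n
  have code: "if Ex (good n) then good n (code n) else valid_code n (code n)" for n
    unfolding code_def by (rule someI_ex, cases "Ex (good n)") (auto simp: exists_valid_code)
  have valid: "valid_code n (code n)" for n
    using code[of n] by (auto simp: good_def split: if_splits)
  have ev': "\<forall>\<^sub>F n in sequentially. good n (code n)"
    using ev unfolding good_def[symmetric] by eventually_elim (use code in meson)
  let ?d = "{..<D} \<times> {..<D}"
  have d: "finite ?d" "?d \<noteq> {}" "(0, 0) \<in> ?d"
    using \<open>D > 0\<close> by auto
  have taps: "finite (tap_sets \<alpha> n)" "({}, {}) \<in> tap_sets \<alpha> n" for n
  proof -
    show "finite (tap_sets \<alpha> n)"
      by (rule finite_subset[of _ "Pow {..<n} \<times> Pow {..<n}"]) (auto simp: tap_sets_def)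
    show "({}, {}) \<in> tap_sets \<alpha> n"
      using \<open>0 \<le> \<alpha>\<close> by (simp add: tap_sets_def)
  qed
  let ?err = "\<lambda>n. Max ((\<lambda>d. error_prob D (num_msgs n R) (code n) d) ` ?d)"
  let ?inner = "\<lambda>n d. Max ((\<lambda>(S1, S2). leakage D n (num_msgs n R) (code n) d S1 S2) ` tap_sets \<alpha> n)"
  let ?leak = "\<lambda>n. Max (?inner n ` ?d)"
  have "?err \<longlonglongrightarrow> 0"
  proof (rule tendsto_sandwich[OF _ _ tendsto_const \<open>e \<longlonglongrightarrow> 0\<close>])
    have "0 \<le> ?err n" for n
    proof -
      have "0 \<le> error_prob D (num_msgs n R) (code n) (0, 0)"
        by (simp add: error_prob_def)
      also have "\<dots> \<le> ?err n"
        using d by (intro Max_ge) auto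
      finally show ?thesis .
    qed
    then show "\<forall>\<^sub>F n in sequentially. 0 \<le> ?err n"
      by simp
    show "\<forall>\<^sub>F n in sequentially. ?err n \<le> e n"
      using ev' by eventually_elim (use d in \<open>auto simp: good_def\<close>)
  qed
  moreover have "?leak \<longlonglongrightarrow> 0"
  proof (rule tendsto_sandwich[OF _ _ tendsto_const \<open>l \<longlonglongrightarrow> 0\<close>])
    have "0 \<le> ?leak n" for n
    proof -
      have "0 \<le> leakage D n (num_msgs n R) (code n) (0, 0) {} {}"
        by (rule leakage_nonneg[OF valid])
      also have "\<dots> \<le> ?inner n (0, 0)"
        using taps[of n] by (intro Max_ge) (auto intro: rev_image_eqI)
      also have "\<dots> \<le> ?leak n"
        using d by (intro Max_ge) auto
      finally show ?thesis .
    qed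
    then show "\<forall>\<^sub>F n in sequentially. 0 \<le> ?leak n"
      by simp
    show "\<forall>\<^sub>F n in sequentially. ?leak n \<le> l n"
      using ev'
    proof eventually_elim
      case (elim n)
      have "?inner n x \<le> l n" for x
      proof -
        have "leakage D n (num_msgs n R) (code n) x S1 S2 \<le> l n" if "(S1, S2) \<in> tap_sets \<alpha> n" for S1 S2
          using elim that unfolding good_def by blast
        then show ?thesis
          using taps[of n] by (subst Max_le_iff) auto
      qed
      then show ?case
        using d by (subst Max_le_iff) auto
    qed
  qed
  ultimately show ?thesis
    unfolding achievable_def using valid by blast
qed

text \<open>The conditions of \<open>scheme_exists\<close> for \<open>m = n - b\<close>, with the
  file size expressed by the rate. The last four lines are encoding of the delivery phase, then
  secrecy of parities over both phases, placement alone and delivery alone.\<close>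

definition admissible :: "nat \<Rightarrow> real \<Rightarrow> real \<Rightarrow> nat \<Rightarrow> nat \<Rightarrow> nat \<Rightarrow> nat \<Rightarrow> nat \<Rightarrow> bool" where
  "admissible D \<alpha> R n b p q r \<longleftrightarrow>
     b \<le> n \<and> q \<le> r \<and> D * p + q \<le> n div 2 \<and> real n * R \<le> real (2 * p + r) \<and>
     (p = 0 \<and> r = 0 \<or> p + 2 * r + b \<le> n - b) \<and>
     (p = 0 \<and> r = 0 \<or> real (2 * D * p + (p + 2 * r) + (b + 2)) \<le> 2 * real (n - b) - \<alpha> * real n) \<and>
     (p = 0 \<or> real (2 * D * p + (b + 2)) \<le> real (n - b) - \<alpha> * real n) \<and>
     (p = 0 \<and> q = r \<or> real (p + 2 * (r - q) + (b + 2)) \<le> real (n - b) - \<alpha> * real n)"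

text \<open>The error is of order n and the leakage of order n^2 over the number
  \<open>2 ^ b\<close> of seeds, which is exponential in n for every fixed \<epsilon>.\<close>

lemma achievable_if_admissible:
  assumes "D > 0" "0 \<le> \<alpha>" "\<epsilon> > 0"
    and ev: "\<forall>\<^sub>F n in sequentially. \<exists>p q r. admissible D \<alpha> R n (nat \<lfloor>\<epsilon> * real n\<rfloor>) p q r"
  shows "achievable D \<alpha> R"
proof -
  define s where "s n = 2 powr (\<epsilon> * real n - 1)" for n
  define e where "e n = 2 * (2 * real n + 4) / s n" for n
  define l where "l n = (2 * real n + 4) / s n * (real D * (real n * \<bar>R\<bar> + 1))" for n
  have "e \<longlonglongrightarrow> 0"
    unfolding e_def s_def using \<open>\<epsilon> > 0\<close> by real_asymp
  \<comment> \<open>The limit of \<open>l\<close> is reduced to two limits in which \<open>D\<close>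
    and \<open>R\<close> do not occur.\<close>
  have "(\<lambda>n. (2 * real n + 4) / s n * (real n + 1)) \<longlonglongrightarrow> 0"
    unfolding s_def using \<open>\<epsilon> > 0\<close> by real_asymp
  moreover have "(\<lambda>n. (2 * real n + 4) / s n) \<longlonglongrightarrow> 0"
    unfolding s_def using \<open>\<epsilon> > 0\<close> by real_asymp
  ultimately have "(\<lambda>n. real D * \<bar>R\<bar> * ((2 * real n + 4) / s n * (real n + 1))
      + (real D - real D * \<bar>R\<bar>) * ((2 * real n + 4) / s n))
    \<longlonglongrightarrow> real D * \<bar>R\<bar> * 0 + (real D - real D * \<bar>R\<bar>) * 0"
    by (intro tendsto_intros)
  moreover have "t * (c * (k * a + 1)) = c * a * (t * (k + 1)) + (c - c * a) * t" for t c k a :: real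
    by (simp add: algebra_simps)
  ultimately have "l \<longlonglongrightarrow> 0"
    unfolding l_def by simp
  show ?thesis
  proof (rule achievableI[OF assms(1,2) \<open>e \<longlonglongrightarrow> 0\<close> \<open>l \<longlonglongrightarrow> 0\<close>])
    show "\<forall>\<^sub>F n in sequentially. \<exists>c. valid_code n c \<and>
      (\<forall>d\<in>{..<D} \<times> {..<D}. error_prob D (num_msgs n R) c d \<le> e n) \<and>
      (\<forall>d. \<forall>(S1, S2)\<in>tap_sets \<alpha> n. leakage D n (num_msgs n R) c d S1 S2 \<le> l n)"
      using ev
    proof eventually_elim
      case (elim n)
      define b where "b = nat \<lfloor>\<epsilon> * real n\<rfloor>"
      obtain p q r where adm: "admissible D \<alpha> R n b p q r"
        using elim unfolding b_def by blast
      have "\<epsilon> * real n - 1 \<le> real b"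
        unfolding b_def by linarith
      then have "s n \<le> 2 powr real b"
        unfolding s_def by (intro powr_mono) auto
      then have s: "s n \<le> 2 ^ b" "s n > 0"
        by (simp_all add: powr_realpow s_def)
      let ?M = "num_msgs n R"
      have "?M \<le> 2 ^ (2 * p + r)"
        using adm by (intro num_msgs_le) (simp add: admissible_def)
      then obtain c where c: "valid_code n c"
        "\<forall>d\<in>{..<D} \<times> {..<D}. error_prob D ?M c d \<le> 2 * (2 * real n + 4) / 2 ^ b"
        "\<forall>d. \<forall>(S1, S2)\<in>tap_sets \<alpha> n. leakage D n ?M c d S1 S2
          \<le> (2 * real n + 4) / 2 ^ b * (real D * log 2 (real ?M))"
        using scheme_exists[of b n q r D p ?M "n - b" \<alpha>] adm num_msgs_pos[of n R] \<open>0 \<le> \<alpha>\<close>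
        unfolding admissible_def by blast
      have err: "2 * (2 * real n + 4) / 2 ^ b \<le> e n"
        unfolding e_def using s by (intro divide_left_mono) auto
      have leak: "(2 * real n + 4) / 2 ^ b * (real D * log 2 (real ?M)) \<le> l n"
        unfolding l_def using s log_num_msgs_le[of n R] num_msgs_pos[of n R]
        by (intro mult_mono divide_left_mono) (auto simp: Suc_le_eq)
      have "\<forall>d\<in>{..<D} \<times> {..<D}. error_prob D ?M c d \<le> e n"
        using c(2) err by (meson order_trans)
      moreover have "\<forall>d. \<forall>(S1, S2)\<in>tap_sets \<alpha> n. leakage D n ?M c d S1 S2 \<le> l n"
      proof (intro allI ballI, clarify)
        fix d S1 S2 assume "(S1, S2) \<in> tap_sets \<alpha> n"
        then have "leakage D n ?M c d S1 S2 \<le> (2 * real n + 4) / 2 ^ b * (real D * log 2 (real ?M))"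
          using c(3) by blast
        then show "leakage D n ?M c d S1 S2 \<le> l n"
          using leak by (rule order_trans)
      qed
      ultimately show ?case
        using c(1) by blast
    qed
  qed
qed

section \<open>Rate parameters in the two tapping regimes\<close>

lemma eventually_ge_linear:
  fixes \<epsilon> :: real
  assumes "\<epsilon> > 0"
  shows "\<forall>\<^sub>F n in sequentially. 5 \<le> \<epsilon> * real n"
  using assms by real_asymp

lemma achievable_low_tapping:
  assumes "D > 2" "0 < \<alpha>" "\<alpha> < 1" and R: "R < 1/2 + 3 * (1 - \<alpha>) / (4 * real D)"
  shows "achievable D \<alpha> R"
proof -
  define \<delta> where "\<delta> = 1/2 + 3 * (1 - \<alpha>) / (4 * real D) - R"
  \<comment> \<open>The first term pays for the loss of rate, at most 4e + 3 with e = \<epsilon>n;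
    the second leaves room for a positive \<open>p\<close>.\<close>
  define \<epsilon> where "\<epsilon> = min (\<delta> / 8) ((1 - \<alpha>) / (8 * real D))"
  have \<epsilon>: "\<epsilon> > 0" "8 * \<epsilon> \<le> \<delta>" "8 * real D * \<epsilon> \<le> 1 - \<alpha>"
    using assms by (auto simp: \<epsilon>_def \<delta>_def min_def field_simps)
  show ?thesis
  proof (rule achievable_if_admissible[OF _ _ \<epsilon>(1)])
    show "\<forall>\<^sub>F n in sequentially. \<exists>p q r. admissible D \<alpha> R n (nat \<lfloor>\<epsilon> * real n\<rfloor>) p q r"
      using eventually_ge_linear[OF \<epsilon>(1)]
    proof eventually_elim
      case (elim n)
      define x where "x = real n"
      define e where "e = \<epsilon> * x"
      define De where "De = real D * e"
      define \<beta> where "\<beta> = (1 - \<alpha>) * x"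
      define \<gamma> where "\<gamma> = \<beta> / (2 * real D)"
      have e: "e \<ge> 5" "e \<le> \<beta> / 24" "\<beta> \<le> x" "De \<ge> 3 * e" "8 * De \<le> \<beta>" "8 * e \<le> \<delta> * x"
      proof -
        have x: "x \<ge> 0"
          by (simp add: x_def)
        show "e \<ge> 5"
          using elim by (simp add: e_def x_def)
        then show "De \<ge> 3 * e"
          using assms(1) unfolding De_def by (intro mult_right_mono) auto
        show "8 * De \<le> \<beta>"
          using mult_right_mono[OF \<epsilon>(3) x] by (simp add: De_def e_def \<beta>_def algebra_simps)
        then show "e \<le> \<beta> / 24"
          using \<open>De \<ge> 3 * e\<close> by linarith
        show "\<beta> \<le> x"
          using x assms by (simp add: \<beta>_def mult_left_le_one_le)
        show "8 * e \<le> \<delta> * x"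
          using mult_right_mono[OF \<epsilon>(2) x] by (simp add: e_def)
      qed
      have D\<gamma>: "real D * \<gamma> = \<beta> / 2" and \<gamma>: "\<gamma> \<le> \<beta> / 6" "4 * e \<le> \<gamma>"
      proof -
        show "real D * \<gamma> = \<beta> / 2"
          using assms by (simp add: \<gamma>_def)
        show "\<gamma> \<le> \<beta> / 6"
          unfolding \<gamma>_def using assms e by (intro divide_left_mono) auto
        show "4 * e \<le> \<gamma>"
          using e(5) assms by (simp add: \<gamma>_def De_def field_simps)
      qed
      define b where "b = nat \<lfloor>e\<rfloor>"
      \<comment> \<open>The reserve 2e appears multiplied by 2D in the cache and placement
        conditions, where it covers the seed and all rounding.\<close>
      define p where "p = nat \<lfloor>\<gamma> - 2 * e\<rfloor>"
      define h where "h = \<alpha> * x / 2"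
      \<comment> \<open>Rounded up, because secrecy of the unmasked delivered bits relies on
        \<alpha>n <= 2q.\<close>
      define q where "q = nat \<lceil>h\<rceil>"
      have b: "real b \<le> e" "e - 1 \<le> real b"
        using e unfolding b_def by linarith+
      have p: "real p \<le> \<gamma> - 2 * e" "\<gamma> - 2 * e - 1 \<le> real p"
        using e \<gamma> unfolding p_def by linarith+
      have ax: "\<alpha> * x = x - \<beta>"
        by (simp add: \<beta>_def algebra_simps)
      have q: "\<alpha> * x \<le> 2 * real q" "2 * real q \<le> \<alpha> * x + 2"
      proof -
        have "h \<ge> 0" "2 * h = \<alpha> * x"
          using e by (simp_all add: h_def ax)
        then have "h \<le> real q" "real q \<le> h + 1"
          unfolding q_def by linarith+
        then show "\<alpha> * x \<le> 2 * real q" "2 * real q \<le> \<alpha> * x + 2"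
          using \<open>2 * h = \<alpha> * x\<close> by linarith+
      qed
      have Dp: "2 * real (D * p) \<le> \<beta> - 4 * De"
        using mult_left_mono[OF p(1), of "real D"] D\<gamma> by (simp add: De_def algebra_simps)
      have "real (2 * b + 2 + p) \<le> real n"
        using e b p \<gamma> unfolding x_def[symmetric] by simp
      then have n: "2 * b + 2 + p \<le> n"
        by linarith
      \<comment> \<open>The largest \<open>r\<close> that leaves room for delivery, with the seed
        length counted twice: once for the \<open>b\<close> lost positions and once as
        slack.\<close>
      define r where "r = (n - (2 * b + 2 + p)) div 2"
      have r: "2 * r + (2 * b + 2 + p) \<le> n" "n \<le> 2 * r + (2 * b + 3 + p)"
        using n by (auto simp: r_def)
      have rr: "2 * real r + (2 * real b + 2 + real p) \<le> x" "x \<le> 2 * real r + (2 * real b + 3 + real p)"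
        using r unfolding x_def by linarith+
      have "real q \<le> real r"
        using q(2) rr(2) b p \<gamma> e unfolding ax by linarith
      then have qr: "q \<le> r"
        by simp
      have "real (2 * (D * p + q)) \<le> real n"
        using Dp q(2) e unfolding ax x_def[symmetric] by simp
      then have "2 * (D * p + q) \<le> n"
        unfolding of_nat_le_iff .
      then have "D * p + q \<le> n div 2"
        by simp
      moreover have "real n * R \<le> real (2 * p + r)"
      proof -
        have "x * (1/2 + 3 * (1 - \<alpha>) / (4 * real D)) = x / 2 + 3 / 2 * \<gamma>"
          by (simp add: \<gamma>_def \<beta>_def algebra_simps)
        then have "x * R = x / 2 + 3 / 2 * \<gamma> - \<delta> * x"
          by (simp add: \<delta>_def algebra_simps)
        then show ?thesis
          using e p rr(2) b unfolding x_def[symmetric] by simp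
      qed
      moreover have nb: "real (n - b) = x - real b" "b \<le> n"
        using n by (auto simp: x_def)
      moreover have "p + 2 * r + b \<le> n - b"
        using r by linarith
      moreover have "real (2 * D * p + (p + 2 * r) + (b + 2)) \<le> 2 * real (n - b) - \<alpha> * real n"
        using Dp rr(1) b e unfolding nb ax x_def[symmetric] by (simp add: algebra_simps)
      moreover have "real (2 * D * p + (b + 2)) \<le> real (n - b) - \<alpha> * real n"
        using Dp b e unfolding nb ax x_def[symmetric] by (simp add: algebra_simps)
      moreover have "real (p + 2 * (r - q) + (b + 2)) \<le> real (n - b) - \<alpha> * real n"
        using rr(1) q(1) qr b unfolding nb x_def[symmetric] by (simp add: of_nat_diff)
      ultimately have "admissible D \<alpha> R n b p q r"
        using qr unfolding admissible_def by blast
      then show ?case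
        unfolding b_def e_def x_def by blast
    qed
  qed (use assms in auto)
qed

text \<open>With \<open>p = 0\<close> and \<open>q = r\<close> every delivered bit is masked, so all
  parities involve both phases and only their joint secrecy condition remains. The bound \<alpha> >=
  1 makes the \<open>r\<close> keys fit into the cache.\<close>

lemma achievable_high_tapping:
  assumes "D > 0" "1 \<le> \<alpha>" "0 < R" "R < 1 - \<alpha> / 2"
  shows "achievable D \<alpha> R"
proof -
  define \<epsilon> where "\<epsilon> = (1 - \<alpha> / 2 - R) / 4"
  have \<epsilon>: "\<epsilon> > 0" "\<epsilon> \<le> 1/8"
    using assms by (auto simp: \<epsilon>_def)
  show ?thesis
  proof (rule achievable_if_admissible[OF _ _ \<epsilon>(1)])
    show "\<forall>\<^sub>F n in sequentially. \<exists>p q r. admissible D \<alpha> R n (nat \<lfloor>\<epsilon> * real n\<rfloor>) p q r"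
      using eventually_ge_linear[OF \<epsilon>(1)]
    proof eventually_elim
      case (elim n)
      define x where "x = real n"
      define e where "e = \<epsilon> * x"
      define y where "y = \<alpha> * x"
      define b where "b = nat \<lfloor>e\<rfloor>"
      define z where "z = R * x"
      have x: "x \<ge> 0"
        by (simp add: x_def)
      have "4 * e = (1 - \<alpha> / 2 - R) * x"
        by (simp add: e_def \<epsilon>_def)
      then have e4: "4 * e = x - y / 2 - z"
        by (simp add: y_def z_def left_diff_distrib)
      have e: "e \<ge> 5" "e \<le> x / 8" "x \<le> y" "z \<ge> 0"
        using elim mult_right_mono[OF \<epsilon>(2) x] mult_right_mono[OF assms(2) x] assms(3) x
        by (simp_all add: e_def x_def[symmetric] y_def z_def)
      have b: "real b \<le> e" "e - 1 \<le> real b"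
        using e unfolding b_def by linarith+
      \<comment> \<open>Solves \<open>2 * r + (b + 2) = 2 * (n - b) - \<alpha> * n\<close> before
        rounding. The rate lost, at most 3b/2 + 2, is below the gap 4e.\<close>
      define r where "r = nat \<lfloor>x - y / 2 - 3 / 2 * real b - 1\<rfloor>"
      have r: "real r \<le> x - y / 2 - 3 / 2 * real b - 1" "x - y / 2 - 3 / 2 * real b - 2 \<le> real r"
        using e e4 b unfolding r_def by linarith+
      have bn: "b \<le> n"
        using b(1) e unfolding x_def by linarith
      then have nb: "real (n - b) = x - real b"
        by (simp add: x_def)
      have "real (2 * r) \<le> real n"
        using r(1) e e4 unfolding x_def[symmetric] by simp
      then have "D * 0 + r \<le> n div 2"
        by linarith
      moreover have "real n * R \<le> real (2 * 0 + r)"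
        using r(2) e e4 b unfolding x_def[symmetric] by (simp add: z_def mult.commute)
      moreover have "0 + 2 * r + b \<le> n - b"
      proof -
        have "real (2 * r + b) \<le> real (n - b)"
          using r(1) e e4 b unfolding nb by simp
        then show ?thesis
          by linarith
      qed
      moreover have "real (2 * D * 0 + (0 + 2 * r) + (b + 2)) \<le> 2 * real (n - b) - \<alpha> * real n"
        using r(1) unfolding nb x_def[symmetric] by (simp add: y_def)
      ultimately have "admissible D \<alpha> R n b 0 r r"
        using bn unfolding admissible_def by blast
      then show ?case
        unfolding b_def e_def x_def by blast
    qed
  qed (use assms in auto)
qed

text \<open>Such a rate has a single message, so all coordinate sets may be empty. For \<alpha> = 2
  no other rates occur.\<close>

lemma achievable_nonpos_rate:
  assumes "D > 0" "0 \<le> \<alpha>" "R \<le> 0"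
  shows "achievable D \<alpha> R"
proof (rule achievable_if_admissible[OF assms(1,2), of "1/2"])
  have "admissible D \<alpha> R n (nat \<lfloor>1/2 * real n\<rfloor>) 0 0 0" for n
  proof -
    have "nat \<lfloor>1/2 * real n\<rfloor> \<le> n"
      by linarith
    then show ?thesis
      using assms by (simp add: admissible_def mult_nonneg_nonpos)
  qed
  then show "\<forall>\<^sub>F n in sequentially. \<exists>p q r. admissible D \<alpha> R n (nat \<lfloor>1/2 * real n\<rfloor>) p q r"
    by (intro always_eventually allI exI)
qed simp

theorem theorem2:
  fixes D :: nat and \<alpha> R :: real
  assumes "D > 2" and "0 < \<alpha>" and "\<alpha> \<le> 2"
    and "R < (if \<alpha> < 1 then 1/2 + 3 * (1 - \<alpha>) / (4 * real D) else 1 - \<alpha> / 2)"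
  shows "achievable D \<alpha> R"
proof (cases "\<alpha> < 1")
  case True
  then show ?thesis
    using assms by (intro achievable_low_tapping) auto
next
  case False
  then show ?thesis
    using assms achievable_nonpos_rate[of D \<alpha> R] achievable_high_tapping[of D \<alpha> R]
    by (cases "R \<le> 0") auto
qed

end
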